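(* Let $\gamma$ be a smooth closed plane curve, $\alpha\in(0,1)$, and let $p_1,p_2\in\gamma$ be two points with non-parallel tangent lines, with local parametrizations $\gamma_1(t)=(t,f(t))$, $\gamma_2(s)=(s,g(s))$ where $g(s)=b_0+b_1s+b_2s^2+b_3s^3+b_4s^4+b_5s^5+O(s^6)$. Suppose that the pair of points at $t=s=0$ contributes to the envelope of intermediate lines. (i) Suppose neither $p_1$ nor $p_2$ is an inflection point, and $f(t)=\frac12t^2+a_3t^3+a_4t^4+a_5t^5+O(t^6)$ with $b_0>0$, $b_1>0$, $a_3>0$, $b_1^2-b_0>0$ (so that $b_2=\frac{\alpha-1}{2\alpha}$). Then the condition of regularity of the curve AEIL at $s=0$ (i.e. AEIL is regular at $s=0$ if and only if it holds) is $$\alpha\neq\frac{b_0}{b_1^2},\qquad \alpha\neq 1,\qquad b_3\neq\frac{(\alpha-1)\left(-6\alpha a_3b_0b_1^2+4\alpha a_3b_0^2-3\alpha b_1^3-2a_3b_0^2\right)}{2\alpha b_0\left(6\alpha a_3b_0b_1+3\alpha b_1^2+2\alpha b_0-b_0\right)}.$$ (ii) Suppose $p_1$ is an inflection point, with $f(t)=a_3t^3+O(t^4)$, $a_3\neq0$, and $b_0b_1\neq0$ (so that $b_2=0$). Then the curve AEIL is regular at $s=0$ if $b_3\neq0$; equivalently, if $p_2$ is an (ordinary) inflection point, i.e. $b_2=0$ and $b_3\neq 0$, at $s=0$.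
   Context: Notation: $[\cdot,\cdot]$ is the determinant of two vectors of $\mathbb{R}^2$; $C=\gamma_2(s)-\gamma_1(t)$; $M_\alpha=(1-\alpha)\gamma_1(t)+\alpha\gamma_2(s)$. The intermediate line of a pair of points with non-parallel tangents is the line through $M_\alpha$ and the intersection point of the two tangent lines. Its equation can be written $F(s,t,X)=0$ with $$F(s,t,X)=(1-\alpha)[\gamma_2',C]\,[\gamma_1',X-M_\alpha]+\alpha[\gamma_1',C]\,[\gamma_2',X-M_\alpha]$$ (away from inflections this agrees, up to a nonvanishing smooth factor, with the equation written using affine co-normals $\nu_i(U)=[\gamma_i',U]/[\gamma_i',\gamma_i'']^{1/3}$, so the envelope is the same). The envelope of intermediate lines is the set of $X\in\mathbb{R}^2$ for which there is $(s,t)$ with $F=F_s=F_t=0$ at $(s,t,X)$; AEIL (Affine Envelope of Intermediate Lines) is the part coming from pairs of distinct points with non-parallel tangents. The pair $(s,t)$ is said to contribute when the linear system $F=F_s=F_t=0$ in $X$, viewed as a system of three equations, satisfies its solvability condition: the $3\times3$ determinant with rows $(F_x,F_y,F)$, $(F_{sx},F_{sy},F_s)$, $(F_{tx},F_{ty},F_t)$ evaluated at $X=(0,0)$ vanishes. At $s=t=0$ this amounts to $b_2=\frac{\alpha-1}{2\alpha}$ in case (i) and to $b_2=0$ in case (ii). In both cases, by the implicit function theorem, the contributing pairs near $(0,0)$ form a smooth curve $t=t(s)$ with $t(0)=0$, and near $s=0$ AEIL is the parametrized curve $s\mapsto X(s)$, where $X(s)$ solves $F=F_s=F_t=0$ at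 $(s,t(s))$. It is regular at $s=0$ if $X(s)$ is defined near $s=0$ and $X'(0)\neq0$.
   Formalization: In (i) the denominator of the displayed fraction can vanish under the hypotheses (e.g. α=1/10, b_0=1, b_1=6/5, a_3=23/45), leaving the bound on b_3 undefined; there the last condition is taken to exclude no value of b_3, and otherwise the formula is as displayed. *)

theory Defs
  imports "HOL-Analysis.Analysis" "HOL-Library.Landau_Symbols"
begin

definition nth_deriv :: "nat \<Rightarrow> (real \<Rightarrow> 'a::real_normed_vector) \<Rightarrow> real \<Rightarrow> 'a" where
  "nth_deriv n c = ((\<lambda>h u. vector_derivative h (at u)) ^^ n) c"

text \<open>\<open>C\<^sup>\<infinity>\<close>; used for open sets only.\<close>
definition smooth_on :: "real set \<Rightarrow> (real \<Rightarrow> 'a::real_normed_vector) \<Rightarrow> bool" where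
  "smooth_on S c \<longleftrightarrow> (\<forall>n. \<forall>u\<in>S. nth_deriv n c differentiable (at u))"

text \<open>Closed curves are regular and may cross themselves.\<close>
definition smooth_closed_curve :: "(real \<Rightarrow> real^2) \<Rightarrow> bool" where
  "smooth_closed_curve \<gamma> \<longleftrightarrow>
     smooth_on UNIV \<gamma> \<and> (\<forall>u. vector_derivative \<gamma> (at u) \<noteq> 0) \<and>
     (\<exists>L>0. \<forall>u. \<gamma> (u + L) = \<gamma> u)"

text \<open>The values of \<open>c\<close> away from \<open>0\<close> play no role.\<close>
definition local_parametrization :: "(real \<Rightarrow> real^2) \<Rightarrow> real^2 \<Rightarrow> (real \<Rightarrow> real^2) \<Rightarrow> bool" where
  "local_parametrization \<gamma> p c \<longleftrightarrow> c 0 = p \<and>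
     (\<exists>\<epsilon>>0. \<exists>\<phi>::real \<Rightarrow> real. smooth_on {-\<epsilon><..<\<epsilon>} \<phi> \<and>
        (\<forall>v\<in>{-\<epsilon><..<\<epsilon>}. deriv \<phi> v \<noteq> 0 \<and> c v = \<gamma> (\<phi> v)))"

definition bracket :: "real^2 \<Rightarrow> real^2 \<Rightarrow> real" where
  "bracket u v = det (vector [u, v] :: real^2^2)"

definition nonparallel_tangents :: "(real \<Rightarrow> real^2) \<Rightarrow> (real \<Rightarrow> real^2) \<Rightarrow> real \<Rightarrow> real \<Rightarrow> bool" where
  "nonparallel_tangents \<gamma>1 \<gamma>2 s t \<longleftrightarrow>
     bracket (vector_derivative \<gamma>1 (at t)) (vector_derivative \<gamma>2 (at s)) \<noteq> 0"

definition inflection_at :: "(real \<Rightarrow> real^2) \<Rightarrow> real \<Rightarrow> bool" where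
  "inflection_at c u \<longleftrightarrow> bracket (nth_deriv 1 c u) (nth_deriv 2 c u) = 0"

definition ordinary_inflection_at :: "(real \<Rightarrow> real^2) \<Rightarrow> real \<Rightarrow> bool" where
  "ordinary_inflection_at c u \<longleftrightarrow>
     inflection_at c u \<and> bracket (nth_deriv 1 c u) (nth_deriv 3 c u) \<noteq> 0"

definition intermediate_point ::
    "real \<Rightarrow> (real \<Rightarrow> real^2) \<Rightarrow> (real \<Rightarrow> real^2) \<Rightarrow> real \<Rightarrow> real \<Rightarrow> real^2" where
  "intermediate_point \<alpha> \<gamma>1 \<gamma>2 s t = (1 - \<alpha>) *\<^sub>R \<gamma>1 t + \<alpha> *\<^sub>R \<gamma>2 s"

text \<open>As a function of \<open>X\<close>, this vanishes at \<open>intermediate_point \<alpha> \<gamma>1 \<gamma>2 s t\<close> and at the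
  intersection of the tangent lines to \<open>\<gamma>1\<close> at \<open>t\<close> and to \<open>\<gamma>2\<close> at \<open>s\<close>.\<close>
definition intermediate_line ::
    "real \<Rightarrow> (real \<Rightarrow> real^2) \<Rightarrow> (real \<Rightarrow> real^2) \<Rightarrow> real \<Rightarrow> real \<Rightarrow> real^2 \<Rightarrow> real" where
  "intermediate_line \<alpha> \<gamma>1 \<gamma>2 s t X =
     (let d1 = vector_derivative \<gamma>1 (at t); d2 = vector_derivative \<gamma>2 (at s);
          C = \<gamma>2 s - \<gamma>1 t; M = intermediate_point \<alpha> \<gamma>1 \<gamma>2 s t
      in (1 - \<alpha>) * bracket d2 C * bracket d1 (X - M) + \<alpha> * bracket d1 C * bracket d2 (X - M))"

definition D_s :: "(real \<Rightarrow> real \<Rightarrow> real^2 \<Rightarrow> real) \<Rightarrow> real \<Rightarrow> real \<Rightarrow> real^2 \<Rightarrow> real" where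
  "D_s G s t X = deriv (\<lambda>s. G s t X) s"

definition D_t :: "(real \<Rightarrow> real \<Rightarrow> real^2 \<Rightarrow> real) \<Rightarrow> real \<Rightarrow> real \<Rightarrow> real^2 \<Rightarrow> real" where
  "D_t G s t X = deriv (\<lambda>t. G s t X) t"

definition D_x :: "(real \<Rightarrow> real \<Rightarrow> real^2 \<Rightarrow> real) \<Rightarrow> real \<Rightarrow> real \<Rightarrow> real^2 \<Rightarrow> real" where
  "D_x G s t X = deriv (\<lambda>x. G s t (vector [x, X $ 2])) (X $ 1)"

definition D_y :: "(real \<Rightarrow> real \<Rightarrow> real^2 \<Rightarrow> real) \<Rightarrow> real \<Rightarrow> real \<Rightarrow> real^2 \<Rightarrow> real" where
  "D_y G s t X = deriv (\<lambda>y. G s t (vector [X $ 1, y])) (X $ 2)"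

definition contributes ::
    "real \<Rightarrow> (real \<Rightarrow> real^2) \<Rightarrow> (real \<Rightarrow> real^2) \<Rightarrow> real \<Rightarrow> real \<Rightarrow> bool" where
  "contributes \<alpha> \<gamma>1 \<gamma>2 s t \<longleftrightarrow>
     (let F = intermediate_line \<alpha> \<gamma>1 \<gamma>2;
          row = (\<lambda>G. vector [D_x G s t 0, D_y G s t 0, G s t 0] :: real^3)
      in det (vector [row F, row (D_s F), row (D_t F)] :: real^3^3) = 0)"

definition AEIL_point ::
    "real \<Rightarrow> (real \<Rightarrow> real^2) \<Rightarrow> (real \<Rightarrow> real^2) \<Rightarrow> real \<Rightarrow> real \<Rightarrow> real^2 \<Rightarrow> bool" where
  "AEIL_point \<alpha> \<gamma>1 \<gamma>2 s t X \<longleftrightarrow>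
     \<gamma>1 t \<noteq> \<gamma>2 s \<and> nonparallel_tangents \<gamma>1 \<gamma>2 s t \<and>
     (let F = intermediate_line \<alpha> \<gamma>1 \<gamma>2
      in F s t X = 0 \<and> D_s F s t X = 0 \<and> D_t F s t X = 0)"

text \<open>Near \<open>(0, 0)\<close> the contributing pairs are the graph \<open>t = \<tau> s\<close>; this determines
  the germ of \<open>\<tau>\<close> at \<open>0\<close>.\<close>
definition contributing_curve ::
    "real \<Rightarrow> (real \<Rightarrow> real^2) \<Rightarrow> (real \<Rightarrow> real^2) \<Rightarrow> (real \<Rightarrow> real) \<Rightarrow> bool" where
  "contributing_curve \<alpha> \<gamma>1 \<gamma>2 \<tau> \<longleftrightarrow>
     \<tau> 0 = 0 \<and> (\<exists>\<epsilon>>0. smooth_on {-\<epsilon><..<\<epsilon>} \<tau>) \<and>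
     (\<forall>\<^sub>F (s, t) in nhds (0, 0). contributes \<alpha> \<gamma>1 \<gamma>2 s t \<longleftrightarrow> t = \<tau> s)"

text \<open>AEIL is parametrized by \<open>s \<mapsto> X s\<close>, where \<open>X s\<close> is the only solution of
  \<open>F = F\<^sub>s = F\<^sub>t = 0\<close> at \<open>(s, \<tau> s)\<close>; if there is no solution, or more than one, then
  the curve is not defined at \<open>s\<close>.\<close>
definition AEIL_regular_at_0 ::
    "real \<Rightarrow> (real \<Rightarrow> real^2) \<Rightarrow> (real \<Rightarrow> real^2) \<Rightarrow> (real \<Rightarrow> real) \<Rightarrow> bool" where
  "AEIL_regular_at_0 \<alpha> \<gamma>1 \<gamma>2 \<tau> \<longleftrightarrow>
     (\<exists>X. (\<forall>\<^sub>F s in nhds 0. \<forall>Y. AEIL_point \<alpha> \<gamma>1 \<gamma>2 s (\<tau> s) Y \<longleftrightarrow> Y = X s) \<and>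
          X differentiable (at 0) \<and> vector_derivative X (at 0) \<noteq> 0)"

end

theory Submission
  imports Defs
begin

text \<open>Write \<open>W = g'(s) - f'(t)\<close>, \<open>P = [\<gamma>\<^sub>1', C]\<close> and \<open>Q = [\<gamma>\<^sub>2', C]\<close>, so that the intermediate line is
  \<open>[N, X - M] = 0\<close> with \<open>N = (1 - \<alpha>) Q \<gamma>\<^sub>1' + \<alpha> P \<gamma>\<^sub>2' = (B, -A)\<close>. The solvability determinant is, up to
  a nonzero constant, \<open>W \<Phi>\<close> with \<open>\<Phi> = (1 - \<alpha>) Q\<^sup>3 f'' + \<alpha> P\<^sup>3 g''\<close>, and \<open>\<Phi>\<^sub>t(0, 0) \<noteq> 0\<close> in both cases, so that the
  contributing pairs form a graph \<open>t = \<tau>(s)\<close>, smooth because \<open>\<tau>' = -\<Phi>\<^sub>s / \<Phi>\<^sub>t\<close>. On this graph the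
  envelope point is \<open>M + L N\<close> with \<open>L = -(1 - \<alpha>) Q W / S\<close> and \<open>S = (1 - \<alpha>) Q W\<^sup>2 + P\<^sup>2 g''\<close>. In case (i), \<open>S\<close>
  vanishes at \<open>0\<close> exactly if \<open>\<alpha> = b\<^sub>0 / b\<^sub>1\<^sup>2\<close>, and then there is no envelope point at \<open>s = 0\<close>;
  otherwise the derivative of the envelope at \<open>0\<close> is a multiple of \<open>N\<close>, the factor being proportional
  to \<open>D b\<^sub>3 - N'\<close>, where \<open>N' / D\<close> is the excluded value of \<open>b\<^sub>3\<close>.\<close>

subsection \<open>Finitely often differentiable functions\<close>

text \<open>The derivative is existentially quantified, so only its values on \<open>S\<close> are
  constrained, and closure under the operations below follows by induction on \<open>n\<close>.
  Smoothness on an open set is this property for all \<open>n\<close>.\<close>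

primrec times_differentiable_on :: "nat \<Rightarrow> real set \<Rightarrow> (real \<Rightarrow> real) \<Rightarrow> bool" where
  "times_differentiable_on 0 S f \<longleftrightarrow> True"
| "times_differentiable_on (Suc n) S f \<longleftrightarrow>
     (\<exists>f'. (\<forall>x\<in>S. (f has_real_derivative f' x) (at x)) \<and> times_differentiable_on n S f')"

lemma times_differentiable_on_SucI:
  "(\<And>x. x \<in> S \<Longrightarrow> (f has_real_derivative f' x) (at x)) \<Longrightarrow> times_differentiable_on n S f' \<Longrightarrow>
   times_differentiable_on (Suc n) S f"
  by auto

lemma times_differentiable_on_SucE:
  assumes "times_differentiable_on (Suc n) S f"
  obtains f' where "\<forall>x\<in>S. (f has_real_derivative f' x) (at x)" "times_differentiable_on n S f'"
  using assms by auto

declare times_differentiable_on.simps(2) [simp del]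

lemma times_differentiable_on_SucD:
  "times_differentiable_on (Suc n) S f \<Longrightarrow> times_differentiable_on n S f"
proof (induction n arbitrary: f)
  case (Suc n)
  from Suc.prems obtain f' where
    "\<forall>x\<in>S. (f has_real_derivative f' x) (at x)" "times_differentiable_on (Suc n) S f'"
    by (rule times_differentiable_on_SucE)
  with Suc.IH show ?case by (blast intro: times_differentiable_on_SucI)
qed simp

lemma times_differentiable_on_subset:
  "times_differentiable_on n S f \<Longrightarrow> T \<subseteq> S \<Longrightarrow> times_differentiable_on n T f"
proof (induction n arbitrary: f)
  case (Suc n)
  from Suc.prems(1) obtain f' where
    "\<forall>x\<in>S. (f has_real_derivative f' x) (at x)" "times_differentiable_on n S f'"
    by (rule times_differentiable_on_SucE)
  with Suc.IH Suc.prems(2) show ?case by (intro times_differentiable_on_SucI[of _ _ f']) auto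
qed simp

lemma times_differentiable_on_cong:
  assumes "open S" "\<And>x. x \<in> S \<Longrightarrow> f x = g x" "times_differentiable_on n S f"
  shows "times_differentiable_on n S g"
proof (cases n)
  case (Suc m)
  with assms(3) obtain f' where f': "\<forall>x\<in>S. (f has_real_derivative f' x) (at x)"
    "times_differentiable_on m S f'"
    by (auto simp: times_differentiable_on.simps(2))
  have "(g has_real_derivative f' x) (at x)" if "x \<in> S" for x
    using bspec[OF f'(1) that] assms(1) that assms(2) by (rule has_field_derivative_transform_within_open)
  with f'(2) show ?thesis unfolding Suc by (rule times_differentiable_on_SucI[rotated])
qed simp

lemma times_differentiable_on_const: "times_differentiable_on n S (\<lambda>x. c)"
proof (induction n arbitrary: c)
  case (Suc n)
  show ?case by (rule times_differentiable_on_SucI[OF DERIV_const Suc.IH])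
qed simp

lemma times_differentiable_on_ident: "times_differentiable_on n S (\<lambda>x. x)"
proof (cases n)
  case (Suc m)
  show ?thesis unfolding Suc by (rule times_differentiable_on_SucI[OF DERIV_ident times_differentiable_on_const])
qed simp

lemma times_differentiable_on_add:
  "times_differentiable_on n S f \<Longrightarrow> times_differentiable_on n S g \<Longrightarrow>
   times_differentiable_on n S (\<lambda>x. f x + g x)"
proof (induction n arbitrary: f g)
  case (Suc n)
  from Suc.prems(1) obtain f' where f: "\<forall>x\<in>S. (f has_real_derivative f' x) (at x)"
    "times_differentiable_on n S f'" by (rule times_differentiable_on_SucE)
  from Suc.prems(2) obtain g' where g: "\<forall>x\<in>S. (g has_real_derivative g' x) (at x)"
    "times_differentiable_on n S g'" by (rule times_differentiable_on_SucE)
  show ?case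
    using f g by (intro times_differentiable_on_SucI[of S _ "\<lambda>x. f' x + g' x"] DERIV_add Suc.IH) auto
qed simp

lemma times_differentiable_on_mult:
  "times_differentiable_on n S f \<Longrightarrow> times_differentiable_on n S g \<Longrightarrow>
   times_differentiable_on n S (\<lambda>x. f x * g x)"
proof (induction n arbitrary: f g)
  case (Suc n)
  from Suc.prems(1) obtain f' where f: "\<forall>x\<in>S. (f has_real_derivative f' x) (at x)"
    "times_differentiable_on n S f'" by (rule times_differentiable_on_SucE)
  from Suc.prems(2) obtain g' where g: "\<forall>x\<in>S. (g has_real_derivative g' x) (at x)"
    "times_differentiable_on n S g'" by (rule times_differentiable_on_SucE)
  have "times_differentiable_on n S (\<lambda>x. f' x * g x + g' x * f x)"
    using f(2) g(2) Suc.prems[THEN times_differentiable_on_SucD]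
    by (intro times_differentiable_on_add Suc.IH)
  then show ?case
    using DERIV_mult[OF bspec[OF f(1)] bspec[OF g(1)]]
    by (intro times_differentiable_on_SucI[rotated]) simp_all
qed simp

lemma times_differentiable_on_diff:
  assumes "times_differentiable_on n S f" "times_differentiable_on n S g"
  shows "times_differentiable_on n S (\<lambda>x. f x - g x)"
  using times_differentiable_on_add[OF assms(1) times_differentiable_on_mult[OF
      times_differentiable_on_const[of n S "-1"] assms(2)]] by simp

lemma times_differentiable_on_inverse:
  "times_differentiable_on n S f \<Longrightarrow> (\<And>x. x \<in> S \<Longrightarrow> f x \<noteq> 0) \<Longrightarrow>
   times_differentiable_on n S (\<lambda>x. inverse (f x))"
proof (induction n)
  case (Suc n)
  from Suc.prems(1) obtain f' where f: "\<forall>x\<in>S. (f has_real_derivative f' x) (at x)"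
    "times_differentiable_on n S f'" by (rule times_differentiable_on_SucE)
  \<comment> \<open>The derivative of \<open>1 / f\<close> involves only \<open>1 / f\<close> and
    \<open>f'\<close>, so the induction closes for fixed \<open>f\<close>. The form
    \<open>0 -\<close> turns the negation into a difference.\<close>
  have "times_differentiable_on n S (\<lambda>x. 0 - inverse (f x) * f' x * inverse (f x))"
    using f Suc by (intro times_differentiable_on_mult times_differentiable_on_diff
        times_differentiable_on_const Suc.IH) (auto dest: times_differentiable_on_SucD)
  then show ?case
    using DERIV_inverse'[OF bspec[OF f(1)] Suc.prems(2)]
    by (intro times_differentiable_on_SucI[rotated]) simp_all
qed simp

lemma times_differentiable_on_divide:
  assumes "times_differentiable_on n S f" "times_differentiable_on n S g" "\<And>x. x \<in> S \<Longrightarrow> g x \<noteq> 0"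
  shows "times_differentiable_on n S (\<lambda>x. f x / g x)"
  unfolding divide_inverse
  by (intro times_differentiable_on_mult times_differentiable_on_inverse assms)

lemma times_differentiable_on_power:
  assumes "times_differentiable_on n S f"
  shows "times_differentiable_on n S (\<lambda>x. f x ^ k)"
proof (induction k)
  case (Suc k)
  from times_differentiable_on_mult[OF assms this] show ?case by simp
qed (simp add: times_differentiable_on_const)

lemma times_differentiable_on_compose:
  "times_differentiable_on n T f \<Longrightarrow> times_differentiable_on n S g \<Longrightarrow> (\<And>x. x \<in> S \<Longrightarrow> g x \<in> T) \<Longrightarrow>
   times_differentiable_on n S (\<lambda>x. f (g x))"
proof (induction n arbitrary: f)
  case (Suc n)
  from Suc.prems(1) obtain f' where f: "\<forall>x\<in>T. (f has_real_derivative f' x) (at x)"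
    "times_differentiable_on n T f'" by (rule times_differentiable_on_SucE)
  from Suc.prems(2) obtain g' where g: "\<forall>x\<in>S. (g has_real_derivative g' x) (at x)"
    "times_differentiable_on n S g'" by (rule times_differentiable_on_SucE)
  have "times_differentiable_on n S (\<lambda>x. f' (g x) * g' x)"
    using Suc.IH[OF f(2) times_differentiable_on_SucD[OF Suc.prems(2)] Suc.prems(3)] g(2)
    by (rule times_differentiable_on_mult)
  moreover have "((\<lambda>x. f (g x)) has_real_derivative f' (g x) * g' x) (at x)" if "x \<in> S" for x
    using DERIV_chain2[OF bspec[OF f(1) Suc.prems(3)[OF that]] bspec[OF g(1) that]] .
  ultimately show ?case by (rule times_differentiable_on_SucI[rotated])
qed simp

lemma times_differentiable_on_deriv:
  assumes "open S" "times_differentiable_on (Suc n) S f"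
  shows "times_differentiable_on n S (deriv f)"
proof -
  from assms(2) obtain f' where "\<forall>x\<in>S. (f has_real_derivative f' x) (at x)"
    "times_differentiable_on n S f'" by (rule times_differentiable_on_SucE)
  note f' = this
  show ?thesis
    by (rule times_differentiable_on_cong[OF assms(1) _ f'(2)]) (use f'(1) in \<open>auto simp: DERIV_imp_deriv\<close>)
qed

lemma times_differentiable_on_DERIV:
  assumes "times_differentiable_on (Suc n) S f" "x \<in> S"
  shows "(f has_real_derivative deriv f x) (at x)"
  using assms by (metis times_differentiable_on_SucE DERIV_imp_deriv)

section \<open>Comparison with iterated vector derivatives\<close>

lemma nth_deriv_Suc: "nth_deriv (Suc n) c = (\<lambda>u. vector_derivative (nth_deriv n c) (at u))"
  by (simp add: nth_deriv_def)

lemma nth_deriv_0 [simp]: "nth_deriv 0 c = c"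
  by (simp add: nth_deriv_def)

text \<open>Peeling off the innermost derivative lets inductions on the order replace
  \<open>c\<close> by its derivative.\<close>

lemma nth_deriv_Suc': "nth_deriv (Suc n) c = nth_deriv n (\<lambda>u. vector_derivative c (at u))"
  by (simp add: nth_deriv_def funpow_Suc_right del: funpow.simps)

lemma vector_derivative_real_eq:
  "(f has_real_derivative y) (at x) \<Longrightarrow> vector_derivative f (at x) = y"
  by (simp add: has_real_derivative_iff_has_vector_derivative vector_derivative_at)

lemma smooth_on_times_differentiable_on:
  fixes f :: "real \<Rightarrow> real"
  assumes "smooth_on S f"
  shows "times_differentiable_on n S f"
  using assms
proof (induction n arbitrary: f)
  case (Suc n)
  have "smooth_on S (\<lambda>u. vector_derivative f (at u))"
    using Suc.prems unfolding smooth_on_def nth_deriv_Suc'[symmetric] by blast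
  moreover have "(f has_real_derivative vector_derivative f (at x)) (at x)" if "x \<in> S" for x
    using Suc.prems that unfolding smooth_on_def has_real_derivative_iff_has_vector_derivative
    by (metis nth_deriv_0 vector_derivative_works)
  ultimately show ?case
    using Suc.IH by (intro times_differentiable_on_SucI)
qed simp

lemma times_differentiable_on_smooth_on:
  fixes f :: "real \<Rightarrow> real"
  assumes "open S" "\<And>n. times_differentiable_on n S f"
  shows "smooth_on S f"
proof -
  have "nth_deriv n f differentiable (at u)" if "u \<in> S" "times_differentiable_on (Suc n) S f" for n u f
    using that(2)
  proof (induction n arbitrary: f)
    case 0
    then show ?case using that(1) times_differentiable_on_DERIV[of 0 S f u] real_differentiable_def by auto
  next
    case (Suc n)
    have "times_differentiable_on (Suc n) S (deriv f)"
      using Suc assms(1) times_differentiable_on_deriv by blast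
    \<comment> \<open>The two notions of derivative are known to agree only on \<open>S\<close>;
      openness of \<open>S\<close> suffices to exchange them.\<close>
    moreover have "deriv f x = vector_derivative f (at x)" if "x \<in> S" for x
      using times_differentiable_on_DERIV[OF Suc.prems that] vector_derivative_real_eq by metis
    ultimately have "times_differentiable_on (Suc n) S (\<lambda>x. vector_derivative f (at x))"
      using times_differentiable_on_cong[OF assms(1)] by meson
    then show ?case using Suc.IH unfolding nth_deriv_Suc' by blast
  qed
  with assms(2) show ?thesis unfolding smooth_on_def by blast
qed

subsection \<open>Taylor coefficients\<close>

text \<open>The Taylor expansion of order \<open>k\<close> at \<open>0\<close> reduces to its remainder, which is
  too large unless the \<open>k\<close>-th derivative vanishes at \<open>0\<close>.\<close>
lemma bigo_power_imp_deriv_eq_0: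
  fixes diff :: "nat \<Rightarrow> real \<Rightarrow> real"
  assumes "e > 0" and D: "\<And>m x. m < n \<Longrightarrow> \<bar>x\<bar> < e \<Longrightarrow> (diff m has_real_derivative diff (Suc m) x) (at x)"
    and "diff 0 \<in> O[at 0](\<lambda>x. x ^ n)" "k < n"
  shows "diff k 0 = 0"
  using assms(4)
proof (induction k rule: less_induct)
  case (less k)
  show ?case
  proof (rule ccontr)
    define c where "c = diff k 0"
    assume "diff k 0 \<noteq> 0"
    then have c: "\<bar>c\<bar> > 0" by (simp add: c_def)
    have "isCont (diff k) 0" using D[OF less.prems, of 0] assms(1) DERIV_isCont by auto
    then obtain d where d: "d > 0" "\<And>x. \<bar>x\<bar> < d \<Longrightarrow> \<bar>diff k x - c\<bar> < \<bar>c\<bar> / 2"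
      using c unfolding continuous_at_eps_delta dist_real_def c_def
      by (metis diff_zero half_gt_zero)
    obtain K where K: "K > 0" "eventually (\<lambda>x. norm (diff 0 x) \<le> K * norm (x ^ n)) (at 0)"
      using assms(3) landau_o.bigE by blast
    from K(2) obtain d' where d': "d' > 0" "\<And>x. x \<noteq> 0 \<Longrightarrow> \<bar>x\<bar> < d' \<Longrightarrow> \<bar>diff 0 x\<bar> \<le> K * \<bar>x ^ n\<bar>"
      unfolding eventually_at dist_real_def by auto
    \<comment> \<open>Chosen so that \<open>K * r\<close> is half of the lower bound
      \<open>\<bar>c\<bar> / 2 / fact k\<close> on \<open>\<bar>diff 0 x\<bar> / x ^ k\<close> that
      holds for small \<open>x > 0\<close>.\<close>
    define r where "r = \<bar>c\<bar> / (4 * fact k * K)"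
    have r: "r > 0" using c K(1) by (simp add: r_def)
    define x where "x = min (min (d/2) (d'/2)) (min (min r (1/2)) (e/2))"
    have x: "x > 0" "x < d" "x < d'" "x \<le> r" "x < 1" "x < e"
      using d(1) d'(1) r assms(1) by (auto simp: x_def min_less_iff_disj)
    have "\<forall>m t. m < k \<and> \<bar>t\<bar> \<le> \<bar>x\<bar> \<longrightarrow> (diff m has_real_derivative diff (Suc m) t) (at t)"
    proof (intro allI impI)
      fix m t assume "m < k \<and> \<bar>t\<bar> \<le> \<bar>x\<bar>"
      with x show "(diff m has_real_derivative diff (Suc m) t) (at t)"
        using less.prems by (intro D) auto
    qed
    from Maclaurin_bi_le[of diff "diff 0" k x, OF refl this]
    obtain t where t: "\<bar>t\<bar> \<le> \<bar>x\<bar>"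
      "diff 0 x = (\<Sum>m<k. diff m 0 / fact m * x ^ m) + diff k t / fact k * x ^ k"
      by auto
    \<comment> \<open>The coefficients below order \<open>k\<close> vanish by the induction
      hypothesis.\<close>
    have "diff 0 x = diff k t / fact k * x ^ k"
      unfolding t(2) using less by (simp add: sum.neutral)
    then have hx: "\<bar>diff 0 x\<bar> = \<bar>diff k t\<bar> / fact k * x ^ k" using x(1) by (simp add: abs_mult)
    have "\<bar>diff k t\<bar> > \<bar>c\<bar> / 2" using d(2)[of t] t(1) x by linarith
    then have "\<bar>diff k t\<bar> / fact k > \<bar>c\<bar> / 2 / fact k" by (intro divide_strict_right_mono) auto
    then have "\<bar>diff 0 x\<bar> > \<bar>c\<bar> / 2 / fact k * x ^ k"
      unfolding hx using x(1) by (intro mult_strict_right_mono) simp_all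
    moreover have "\<bar>diff 0 x\<bar> \<le> K * x ^ Suc k"
    proof -
      have "\<bar>diff 0 x\<bar> \<le> K * x ^ n" using d'(2)[of x] x by simp
      also have "x ^ n \<le> x ^ Suc k" using x less.prems by (intro power_decreasing) auto
      finally show ?thesis using K(1) by simp
    qed
    ultimately have "\<bar>c\<bar> / 2 / fact k * x ^ k < K * x * x ^ k" by (simp add: mult.assoc)
    then have "\<bar>c\<bar> / 2 / fact k < K * x"
      by (rule mult_right_less_imp_less) (use x(1) in simp)
    also have "K * x \<le> K * r" using x K by simp
    also have "K * r = \<bar>c\<bar> / 4 / fact k" using K by (simp add: r_def field_simps)
    finally show False using c by (simp add: field_simps)
  qed
qed

text \<open>The preceding lemma applies to \<open>h\<close> minus the polynomial. A remainder of
  order four already fixes the first four coefficients, so one statement serves the expansions with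
  remainder of order six and the one of case (ii).\<close>

lemma taylor_coefficients:
  fixes h h1 h2 h3 h4 :: "real \<Rightarrow> real"
  assumes e: "e > 0"
    and D: "\<And>x. \<bar>x\<bar> < e \<Longrightarrow> (h has_real_derivative h1 x) (at x)"
      "\<And>x. \<bar>x\<bar> < e \<Longrightarrow> (h1 has_real_derivative h2 x) (at x)"
      "\<And>x. \<bar>x\<bar> < e \<Longrightarrow> (h2 has_real_derivative h3 x) (at x)"
      "\<And>x. \<bar>x\<bar> < e \<Longrightarrow> (h3 has_real_derivative h4 x) (at x)"
    and O: "(\<lambda>x. h x - (c0 + c1 * x + c2 * x^2 + c3 * x^3 + c4 * x^4 + c5 * x^5)) \<in> O[at 0](\<lambda>x. x^4)"
  shows "h 0 = c0" "h1 0 = c1" "h2 0 = 2 * c2" "h3 0 = 6 * c3"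
proof -
  define diff where "diff = (\<lambda>m x. [h x - (c0 + c1 * x + c2 * x^2 + c3 * x^3 + c4 * x^4 + c5 * x^5),
    h1 x - (c1 + 2 * c2 * x + 3 * c3 * x^2 + 4 * c4 * x^3 + 5 * c5 * x^4),
    h2 x - (2 * c2 + 6 * c3 * x + 12 * c4 * x^2 + 20 * c5 * x^3),
    h3 x - (6 * c3 + 24 * c4 * x + 60 * c5 * x^2),
    h4 x - (24 * c4 + 120 * c5 * x)] ! m)"
  have "(diff m has_real_derivative diff (Suc m) x) (at x)" if "m < 4" "\<bar>x\<bar> < e" for m x
  proof -
    consider "m = 0" | "m = 1" | "m = 2" | "m = 3" using \<open>m < 4\<close> by linarith
    then show ?thesis
      using that(2) by cases (auto simp: diff_def eval_nat_numeral intro!: derivative_eq_intros D)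
  qed
  from bigo_power_imp_deriv_eq_0[of e 4 diff, OF e this] O have "\<And>k. k < 4 \<Longrightarrow> diff k 0 = 0"
    by (auto simp: diff_def)
  from this[of 0] this[of 1] this[of 2] this[of 3]
  show "h 0 = c0" "h1 0 = c1" "h2 0 = 2 * c2" "h3 0 = 6 * c3"
    by (simp_all add: diff_def eval_nat_numeral)
qed

subsection \<open>Implicit functions of one variable\<close>

text \<open>The map \<open>G (s, t) = (s, \<Phi> (s, t))\<close> is locally invertible, and
  \<open>\<tau> s\<close> is the second component of its inverse at \<open>(s, 0)\<close>.\<close>

lemma implicit_function:
  fixes \<Phi> \<Phi>\<^sub>1 \<Phi>\<^sub>2 :: "real \<times> real \<Rightarrow> real"
  assumes "open U" "(0, 0) \<in> U"
    and deriv: "\<And>z. z \<in> U \<Longrightarrow> (\<Phi> has_derivative (\<lambda>h. \<Phi>\<^sub>1 z * fst h + \<Phi>\<^sub>2 z * snd h)) (at z)"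
    and cont: "continuous_on U \<Phi>\<^sub>1" "continuous_on U \<Phi>\<^sub>2"
    and zero: "\<Phi> (0, 0) = 0" "\<Phi>\<^sub>2 (0, 0) \<noteq> 0"
  obtains \<tau> d where "d > 0" "\<tau> 0 = 0"
    "\<forall>s. \<bar>s\<bar> < d \<longrightarrow> (s, \<tau> s) \<in> U \<and> \<Phi>\<^sub>2 (s, \<tau> s) \<noteq> 0 \<and>
       (\<tau> has_real_derivative - \<Phi>\<^sub>1 (s, \<tau> s) / \<Phi>\<^sub>2 (s, \<tau> s)) (at s)"
    "\<forall>\<^sub>F z in nhds (0, 0). \<Phi> z = 0 \<longleftrightarrow> snd z = \<tau> (fst z)"
proof -
  define G where "G = (\<lambda>z. (fst z, \<Phi> z))"
  define B0 :: "(real \<times> real) \<Rightarrow>\<^sub>L (real \<times> real)" where "B0 = Blinfun (\<lambda>h. (fst h, 0))"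
  define B1 :: "(real \<times> real) \<Rightarrow>\<^sub>L (real \<times> real)" where "B1 = Blinfun (\<lambda>h. (0, fst h))"
  define B2 :: "(real \<times> real) \<Rightarrow>\<^sub>L (real \<times> real)" where "B2 = Blinfun (\<lambda>h. (0, snd h))"
  have B: "blinfun_apply B0 = (\<lambda>h. (fst h, 0))" "blinfun_apply B1 = (\<lambda>h. (0, fst h))"
    "blinfun_apply B2 = (\<lambda>h. (0, snd h))"
    unfolding B0_def B1_def B2_def
    by (auto intro!: bounded_linear_Blinfun_apply bounded_linear_intros)
  \<comment> \<open>The Jacobian of \<open>G\<close> as a combination of constant linear maps, so
    that its continuity is that of the two coefficients.\<close>
  define G' where "G' = (\<lambda>z. B0 + \<Phi>\<^sub>1 z *\<^sub>R B1 + \<Phi>\<^sub>2 z *\<^sub>R B2)"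
  have G': "blinfun_apply (G' z) = (\<lambda>h. (fst h, \<Phi>\<^sub>1 z * fst h + \<Phi>\<^sub>2 z * snd h))" for z
    by (auto simp: G'_def B plus_blinfun.rep_eq scaleR_blinfun.rep_eq)
  \<comment> \<open>Restricting to this set beforehand keeps \<open>\<Phi>\<^sub>2\<close> nonzero
    along the whole curve.\<close>
  define U' where "U' = {z \<in> U. \<Phi>\<^sub>2 z \<noteq> 0}"
  have U': "open U'"
    unfolding U'_def
    using continuous_open_preimage[OF cont(2) \<open>open U\<close>, of "- {0}"]
    by (simp add: vimage_def Int_def open_Compl)
  have dG: "(G has_derivative blinfun_apply (G' z)) (at z)" if "z \<in> U'" for z
    unfolding G' G_def using that deriv[of z] unfolding U'_def
    by (intro has_derivative_Pair derivative_intros) auto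
  have cG: "continuous_on U' G'"
    unfolding G'_def
    by (intro continuous_intros continuous_on_subset[OF cont(1)] continuous_on_subset[OF cont(2)])
       (auto simp: U'_def)
  \<comment> \<open>The inverse Jacobian at the origin: the equation
    \<open>k = \<Phi>\<^sub>1 * h + \<Phi>\<^sub>2 * x\<close> solved for \<open>x\<close>.\<close>
  define V where "V = B0 + (1 / \<Phi>\<^sub>2 (0,0)) *\<^sub>R (B2 - \<Phi>\<^sub>1 (0,0) *\<^sub>R B1)"
  have inv: "V o\<^sub>L G' (0, 0) = id_blinfun"
    using zero(2) by (intro blinfun_eqI)
      (auto simp: V_def G' B plus_blinfun.rep_eq minus_blinfun.rep_eq scaleR_blinfun.rep_eq field_simps)
  have mem: "(0, 0) \<in> U'" using assms(2) zero by (simp add: U'_def)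
  obtain U1 V1 g g' where g: "open U1" "U1 \<subseteq> U'" "(0, 0) \<in> U1" "open V1" "G (0, 0) \<in> V1"
    "homeomorphism U1 V1 G g" "\<And>y. y \<in> V1 \<Longrightarrow> (g has_derivative g' y) (at y)"
    using inverse_function_theorem[OF U' dG cG mem inv] by metis
  define \<tau> where "\<tau> = (\<lambda>s. snd (g (s, 0)))"
  have G0: "G (0, 0) = (0, 0)" by (simp add: G_def zero)
  have slice: "continuous_on UNIV (\<lambda>s::real. (s, 0::real))"
    by (intro continuous_intros)
  have "open {s. (s, 0::real) \<in> V1}"
    using open_vimage[OF g(4) slice] by (simp add: vimage_def)
  then obtain d where d: "d > 0" "\<And>s. \<bar>s\<bar> < d \<Longrightarrow> (s, 0) \<in> V1"
    using g(5) G0 unfolding open_real_def[symmetric] open_dist dist_real_def by force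
  have gs: "g (s, 0) = (s, \<tau> s) \<and> (s, \<tau> s) \<in> U1 \<and> \<Phi> (s, \<tau> s) = 0" if "\<bar>s\<bar> < d" for s
  proof -
    have "G (g (s, 0)) = (s, 0)" "g (s, 0) \<in> U1"
      using d(2)[OF that] g(6) unfolding homeomorphism_def by auto
    then show ?thesis by (cases "g (s, 0)") (auto simp: \<tau>_def G_def)
  qed
  have \<tau>0: "\<tau> 0 = 0"
    using g(3,6) G0 unfolding homeomorphism_def \<tau>_def by (metis snd_conv)
  have D: "(\<tau> has_real_derivative - \<Phi>\<^sub>1 (s, \<tau> s) / \<Phi>\<^sub>2 (s, \<tau> s)) (at s)" if s: "\<bar>s\<bar> < d" for s
  proof -
    have z: "(s, \<tau> s) \<in> U" "\<Phi>\<^sub>2 (s, \<tau> s) \<noteq> 0" using gs[OF s] g(2) by (auto simp: U'_def)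
    \<comment> \<open>Differentiability of \<open>\<tau>\<close> is inherited from the inverse
      \<open>g\<close>; the value of the derivative then comes from differentiating
      \<open>\<Phi> (s, \<tau> s) = 0\<close>.\<close>
    have "((\<lambda>s. g (s, 0)) has_derivative (\<lambda>h. g' (s, 0) (h, 0))) (at s)"
      by (rule has_derivative_compose[where f = "\<lambda>s. (s, 0)" and g = g and g' = "g' (s, 0)", OF _ g(7)[OF d(2)[OF s]]])
         (auto intro!: derivative_eq_intros)
    then have "(\<tau> has_derivative (\<lambda>h. snd (g' (s, 0) (h, 0)))) (at s)"
      unfolding \<tau>_def by (rule has_derivative_snd)
    then obtain D where D: "(\<tau> has_real_derivative D) (at s)"
      by (metis differentiable_def real_differentiable_def)
    then have "(\<tau> has_derivative (\<lambda>h. D * h)) (at s)" by (simp add: has_field_derivative_def)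
    then have "((\<lambda>s. (s, \<tau> s)) has_derivative (\<lambda>h. (h, D * h))) (at s)"
      by (auto intro!: derivative_eq_intros)
    from has_derivative_compose[where f = "\<lambda>s. (s, \<tau> s)" and g = \<Phi>, OF this deriv[OF z(1)]]
    have 1: "((\<lambda>s. \<Phi> (s, \<tau> s)) has_derivative (\<lambda>h. \<Phi>\<^sub>1 (s, \<tau> s) * h + \<Phi>\<^sub>2 (s, \<tau> s) * (D * h))) (at s)"
      by simp
    have "((\<lambda>s. \<Phi> (s, \<tau> s)) has_derivative (\<lambda>h. 0)) (at s)"
      by (rule has_derivative_transform_within_open[of "\<lambda>s. 0" _ _ _ "{-d<..<d}"])
         (use gs s in \<open>auto simp: abs_less_iff\<close>)
    from fun_cong[OF has_derivative_unique[OF 1 this], of 1] z(2)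
    have "D = - \<Phi>\<^sub>1 (s, \<tau> s) / \<Phi>\<^sub>2 (s, \<tau> s)" by (simp add: field_simps)
    with D show ?thesis by simp
  qed
  have "\<forall>\<^sub>F z in nhds (0, 0). z \<in> U1" using g(1,3) eventually_nhds_in_open by blast
  moreover have "\<forall>\<^sub>F z :: real \<times> real in nhds (0, 0). z \<in> {-d<..<d} \<times> UNIV"
    by (rule eventually_nhds_in_open) (auto intro!: open_Times simp: d)
  ultimately have "\<forall>\<^sub>F z in nhds (0, 0). \<Phi> z = 0 \<longleftrightarrow> snd z = \<tau> (fst z)"
  proof eventually_elim
    case (elim z)
    obtain s t where z: "z = (s, t)" by (cases z)
    \<comment> \<open>If \<open>\<Phi> z = 0\<close>, then \<open>G z = (s, 0)\<close>, and
      injectivity of \<open>G\<close> on \<open>U1\<close> forces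
      \<open>z = (s, \<tau> s)\<close>.\<close>
    have "g (G z) = z" using elim(1) g(6) unfolding homeomorphism_def by auto
    moreover have "\<bar>s\<bar> < d" using elim(2) z by auto
    ultimately show ?case using gs[of s] z by (auto simp: G_def)
  qed
  moreover have "(s, \<tau> s) \<in> U \<and> \<Phi>\<^sub>2 (s, \<tau> s) \<noteq> 0" if "\<bar>s\<bar> < d" for s
    using gs[OF that] g(2) by (auto simp: U'_def)
  ultimately show ?thesis using that[of d \<tau>] d(1) \<tau>0 D by blast
qed

subsection \<open>Intermediate lines of two graphs\<close>

lemma bracket_eq: "bracket u v = u $ 1 * v $ 2 - u $ 2 * v $ 1"
  by (simp add: bracket_def det_2)

lemma vector_2_eq_iff: "(vector [a, b] :: real^2) = vector [c, d] \<longleftrightarrow> a = c \<and> b = d"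
  by (auto simp: vec_eq_iff forall_2)

lemma vec_2_eq_vector_iff: "(X :: real^2) = vector [c, d] \<longleftrightarrow> X $ 1 = c \<and> X $ 2 = d"
  by (auto simp: vec_eq_iff forall_2)

lemma has_vector_derivative_vector_2:
  assumes "(x has_real_derivative x') (at u)" "(y has_real_derivative y') (at u)"
  shows "((\<lambda>u. vector [x u, y u] :: real^2) has_vector_derivative vector [x', y']) (at u)"
proof -
  have v: "(vector [a, b] :: real^2) = a *\<^sub>R axis 1 1 + b *\<^sub>R axis 2 1" for a b
    by (auto simp: vec_eq_iff forall_2 axis_def)
  have "((\<lambda>u. x u *\<^sub>R axis 1 1 + y u *\<^sub>R axis 2 1 :: real^2) has_vector_derivative
      x' *\<^sub>R axis 1 1 + y' *\<^sub>R axis 2 1) (at u)"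
    using assms by (auto intro!: derivative_eq_intros)
  then show ?thesis by (simp add: v)
qed

text \<open>Three derivatives suffice for the velocity at \<open>0\<close>: \<open>\<Phi>\<close>
  and \<open>S\<close> contain second derivatives and are differentiated once. Smoothness of
  \<open>f3\<close> and \<open>g3\<close> passes down to the functions of which they are
  derivatives.\<close>

locale graph_pair =
  fixes \<alpha> e :: real and f f1 f2 f3 g g1 g2 g3 :: "real \<Rightarrow> real"
  assumes \<alpha>: "0 < \<alpha>" "\<alpha> < 1" and e: "0 < e"
    and f: "\<And>t. \<bar>t\<bar> < e \<Longrightarrow> (f has_real_derivative f1 t) (at t)"
      "\<And>t. \<bar>t\<bar> < e \<Longrightarrow> (f1 has_real_derivative f2 t) (at t)"
      "\<And>t. \<bar>t\<bar> < e \<Longrightarrow> (f2 has_real_derivative f3 t) (at t)"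
    and g: "\<And>s. \<bar>s\<bar> < e \<Longrightarrow> (g has_real_derivative g1 s) (at s)"
      "\<And>s. \<bar>s\<bar> < e \<Longrightarrow> (g1 has_real_derivative g2 s) (at s)"
      "\<And>s. \<bar>s\<bar> < e \<Longrightarrow> (g2 has_real_derivative g3 s) (at s)"
    and smooth: "\<And>n. times_differentiable_on n {-e<..<e} f3" "\<And>n. times_differentiable_on n {-e<..<e} g3"
begin

abbreviation \<gamma>1 :: "real \<Rightarrow> real^2" where "\<gamma>1 \<equiv> \<lambda>t. vector [t, f t]"
abbreviation \<gamma>2 :: "real \<Rightarrow> real^2" where "\<gamma>2 \<equiv> \<lambda>s. vector [s, g s]"

definition "W s t = g1 s - f1 t"
definition "P s t = g s - f t - f1 t * (s - t)"
definition "Q s t = g s - f t - g1 s * (s - t)"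
definition "A s t = - ((1 - \<alpha>) * Q s t * f1 t + \<alpha> * P s t * g1 s)"
definition "B s t = (1 - \<alpha>) * Q s t + \<alpha> * P s t"
definition "A_s s t = (1 - \<alpha>) * g2 s * (s - t) * f1 t - \<alpha> * (W s t * g1 s + P s t * g2 s)"
definition "B_s s t = \<alpha> * W s t - (1 - \<alpha>) * g2 s * (s - t)"
definition "A_t s t = \<alpha> * f2 t * (s - t) * g1 s - (1 - \<alpha>) * (W s t * f1 t + Q s t * f2 t)"
definition "B_t s t = (1 - \<alpha>) * W s t - \<alpha> * f2 t * (s - t)"
definition "M1 s t = (1 - \<alpha>) * t + \<alpha> * s"
definition "M2 s t = (1 - \<alpha>) * f t + \<alpha> * g s"
definition "\<Phi> s t = (1 - \<alpha>) * Q s t ^ 3 * f2 t + \<alpha> * P s t ^ 3 * g2 s"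
definition "S s t = (1 - \<alpha>) * Q s t * W s t ^ 2 + P s t ^ 2 * g2 s"

abbreviation "F \<equiv> intermediate_line \<alpha> \<gamma>1 \<gamma>2"

lemma P_minus_Q: "P s t = Q s t + W s t * (s - t)"
  by (simp add: P_def Q_def W_def algebra_simps)

text \<open>The determinant of the linear system \<open>F = F_s = 0\<close> in \<open>X\<close>;
  this is how \<open>S\<close> governs unique solvability. Substituting
  \<open>P = Q + W * (s - t)\<close> leaves a polynomial identity.\<close>

lemma cross_s: "A s t * B_s s t - B s t * A_s s t = \<alpha> * S s t"
  unfolding A_def B_def A_s_def B_s_def S_def P_minus_Q by (simp add: W_def) algebra

lemma cross_t: "A s t * B_t s t - B s t * A_t s t = (1 - \<alpha>) * (Q s t ^ 2 * f2 t - \<alpha> * P s t * W s t ^ 2)"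
  unfolding A_def B_def A_t_def B_t_def P_minus_Q by (simp add: W_def) algebra

lemma vector_derivative_\<gamma>1: "\<bar>t\<bar> < e \<Longrightarrow> vector_derivative \<gamma>1 (at t) = vector [1, f1 t]"
  by (intro vector_derivative_at has_vector_derivative_vector_2 f) auto

lemma vector_derivative_\<gamma>2: "\<bar>s\<bar> < e \<Longrightarrow> vector_derivative \<gamma>2 (at s) = vector [1, g1 s]"
  by (intro vector_derivative_at has_vector_derivative_vector_2 g) auto

lemma F_eq:
  assumes "\<bar>s\<bar> < e" "\<bar>t\<bar> < e"
  shows "F s t X = A s t * (X $ 1 - M1 s t) + B s t * (X $ 2 - M2 s t)"
  using assms
  by (simp add: intermediate_line_def intermediate_point_def Let_def vector_derivative_\<gamma>1
      vector_derivative_\<gamma>2 bracket_eq A_def B_def P_def Q_def M1_def M2_def algebra_simps)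

lemma DERIV_PQ_s:
  assumes "\<bar>s\<bar> < e"
  shows "((\<lambda>s. W s t) has_real_derivative g2 s) (at s)"
    "((\<lambda>s. P s t) has_real_derivative W s t) (at s)"
    "((\<lambda>s. Q s t) has_real_derivative - g2 s * (s - t)) (at s)"
  unfolding W_def P_def Q_def
  by (auto intro!: derivative_eq_intros g assms simp: algebra_simps)

lemma DERIV_PQ_t:
  assumes "\<bar>t\<bar> < e"
  shows "((\<lambda>t. W s t) has_real_derivative - f2 t) (at t)"
    "((\<lambda>t. P s t) has_real_derivative - f2 t * (s - t)) (at t)"
    "((\<lambda>t. Q s t) has_real_derivative W s t) (at t)"
  unfolding W_def P_def Q_def
  by (auto intro!: derivative_eq_intros f assms simp: algebra_simps)

text \<open>The inhomogeneous term is \<open>- [N, M_s]\<close>. As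
  \<open>M_s = \<alpha> \<gamma>2'\<close>, the part of \<open>N\<close> along
  \<open>\<gamma>2'\<close> drops out and \<open>[N, \<gamma>2'] = (1 - \<alpha>) Q W\<close>
  remains.\<close>

lemma DERIV_line_s:
  assumes "\<bar>s\<bar> < e"
  shows "((\<lambda>s. A s t * (x - M1 s t) + B s t * (y - M2 s t)) has_real_derivative
    A_s s t * (x - M1 s t) + B_s s t * (y - M2 s t) - \<alpha> * (1 - \<alpha>) * Q s t * W s t) (at s)"
proof -
  have A: "((\<lambda>s. A s t) has_real_derivative A_s s t) (at s)"
    unfolding A_def A_s_def
    by (auto intro!: derivative_eq_intros DERIV_PQ_s g assms simp: algebra_simps)
  have B: "((\<lambda>s. B s t) has_real_derivative B_s s t) (at s)"
    unfolding B_def B_s_def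
    by (auto intro!: derivative_eq_intros DERIV_PQ_s assms simp: algebra_simps)
  have M: "((\<lambda>s. M1 s t) has_real_derivative \<alpha>) (at s)" "((\<lambda>s. M2 s t) has_real_derivative \<alpha> * g1 s) (at s)"
    unfolding M1_def M2_def by (auto intro!: derivative_eq_intros g assms)
  have "A_s s t * (x - M1 s t) - A s t * \<alpha> + (B_s s t * (y - M2 s t) - B s t * (\<alpha> * g1 s)) =
    A_s s t * (x - M1 s t) + B_s s t * (y - M2 s t) - \<alpha> * (1 - \<alpha>) * Q s t * W s t"
    unfolding A_def B_def W_def by algebra
  then show ?thesis
    by (auto intro!: derivative_eq_intros A B M simp: algebra_simps)
qed

text \<open>Here \<open>M_t = (1 - \<alpha>) \<gamma>1'\<close>, so only the part of
  \<open>N\<close> along \<open>\<gamma>2'\<close> counts; the sign changes because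
  \<open>[\<gamma>2', \<gamma>1'] = - W\<close>.\<close>

lemma DERIV_line_t:
  assumes "\<bar>t\<bar> < e"
  shows "((\<lambda>t. A s t * (x - M1 s t) + B s t * (y - M2 s t)) has_real_derivative
    A_t s t * (x - M1 s t) + B_t s t * (y - M2 s t) + \<alpha> * (1 - \<alpha>) * P s t * W s t) (at t)"
proof -
  have A: "((\<lambda>t. A s t) has_real_derivative A_t s t) (at t)"
    unfolding A_def A_t_def
    by (auto intro!: derivative_eq_intros DERIV_PQ_t f assms simp: algebra_simps)
  have B: "((\<lambda>t. B s t) has_real_derivative B_t s t) (at t)"
    unfolding B_def B_t_def
    by (auto intro!: derivative_eq_intros DERIV_PQ_t assms simp: algebra_simps)
  have M: "((\<lambda>t. M1 s t) has_real_derivative 1 - \<alpha>) (at t)"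
    "((\<lambda>t. M2 s t) has_real_derivative (1 - \<alpha>) * f1 t) (at t)"
    unfolding M1_def M2_def by (auto intro!: derivative_eq_intros f assms)
  have "A_t s t * (x - M1 s t) - A s t * (1 - \<alpha>) + (B_t s t * (y - M2 s t) - B s t * ((1 - \<alpha>) * f1 t)) =
    A_t s t * (x - M1 s t) + B_t s t * (y - M2 s t) + \<alpha> * (1 - \<alpha>) * P s t * W s t"
    unfolding A_def B_def W_def by algebra
  then show ?thesis
    by (auto intro!: derivative_eq_intros A B M simp: algebra_simps)
qed

lemma D_s_F:
  assumes "\<bar>s\<bar> < e" "\<bar>t\<bar> < e"
  shows "D_s F s t X = A_s s t * (X $ 1 - M1 s t) + B_s s t * (X $ 2 - M2 s t) - \<alpha> * (1 - \<alpha>) * Q s t * W s t"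
  unfolding D_s_def
  by (rule DERIV_imp_deriv, rule has_field_derivative_transform_within_open[of _ _ _ "{-e<..<e}",
        OF DERIV_line_s[OF assms(1), of t "X $ 1" "X $ 2"]]) (use assms in \<open>auto simp: F_eq\<close>)

lemma D_t_F:
  assumes "\<bar>s\<bar> < e" "\<bar>t\<bar> < e"
  shows "D_t F s t X = A_t s t * (X $ 1 - M1 s t) + B_t s t * (X $ 2 - M2 s t) + \<alpha> * (1 - \<alpha>) * P s t * W s t"
  unfolding D_t_def
  by (rule DERIV_imp_deriv, rule has_field_derivative_transform_within_open[of _ _ _ "{-e<..<e}",
        OF DERIV_line_t[OF assms(2), of s "X $ 1" "X $ 2"]]) (use assms in \<open>auto simp: F_eq\<close>)

lemma D_xy_affine:
  assumes "\<And>X. G s t X = a * (X $ 1 - m) + b * (X $ 2 - n) + c"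
  shows "D_x G s t X = a" "D_y G s t X = b"
  unfolding D_x_def D_y_def assms
  by (rule DERIV_imp_deriv; auto intro!: derivative_eq_intros)+

text \<open>Moving the origin to \<open>M\<close> is a column operation; it leaves only the
  inhomogeneous terms in the third column. Expansion along it gives a multiple of \<open>W\<close>
  times \<open>Q\<close> times the determinant in \<open>cross_t\<close> plus \<open>P\<close> times
  the one in \<open>cross_s\<close>, and in this sum the terms with \<open>W\<^sup>2\<close> cancel,
  leaving \<open>\<Phi>\<close>.\<close>

lemma contributes_iff:
  assumes "\<bar>s\<bar> < e" "\<bar>t\<bar> < e"
  shows "contributes \<alpha> \<gamma>1 \<gamma>2 s t \<longleftrightarrow> W s t = 0 \<or> \<Phi> s t = 0"
proof -
  have xy: "D_x F s t 0 = A s t" "D_y F s t 0 = B s t"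
    using D_xy_affine[of F s t "A s t" "M1 s t" "B s t" "M2 s t" 0 0] F_eq[OF assms] by simp_all
  have xy_s: "D_x (D_s F) s t 0 = A_s s t" "D_y (D_s F) s t 0 = B_s s t"
    using D_xy_affine[of "D_s F" s t "A_s s t" "M1 s t" "B_s s t" "M2 s t" "- \<alpha> * (1 - \<alpha>) * Q s t * W s t" 0]
      D_s_F[OF assms] by simp_all
  have xy_t: "D_x (D_t F) s t 0 = A_t s t" "D_y (D_t F) s t 0 = B_t s t"
    using D_xy_affine[of "D_t F" s t "A_t s t" "M1 s t" "B_t s t" "M2 s t" "\<alpha> * (1 - \<alpha>) * P s t * W s t" 0]
      D_t_F[OF assms] by simp_all
  have det: "det (vector [vector [a, b, - a * m - b * n], vector [a', b', - a' * m - b' * n - c'],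
      vector [a'', b'', - a'' * m - b'' * n + c'']] :: real^3^3) =
      c' * (a * b'' - b * a'') + c'' * (a * b' - b * a')" for a b a' b' a'' b'' c' c'' m n
    unfolding det_3 vector_3 by algebra
  have "contributes \<alpha> \<gamma>1 \<gamma>2 s t \<longleftrightarrow>
    (\<alpha> * (1 - \<alpha>) * Q s t * W s t) * (A s t * B_t s t - B s t * A_t s t)
    + (\<alpha> * (1 - \<alpha>) * P s t * W s t) * (A s t * B_s s t - B s t * A_s s t) = 0"
    unfolding contributes_def Let_def xy xy_s xy_t F_eq[OF assms] D_s_F[OF assms] D_t_F[OF assms]
    unfolding det[symmetric, where m = "M1 s t" and n = "M2 s t"] by simp
  also have "\<dots> \<longleftrightarrow> \<alpha> * (1 - \<alpha>) * (W s t * \<Phi> s t) = 0"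
    unfolding cross_s cross_t \<Phi>_def S_def by (rule arg_cong[where f = "\<lambda>x. x = 0"]) algebra
  finally show ?thesis using \<alpha> by simp
qed

lemma AEIL_point_iff:
  assumes "\<bar>s\<bar> < e" "\<bar>t\<bar> < e"
  shows "AEIL_point \<alpha> \<gamma>1 \<gamma>2 s t X \<longleftrightarrow> \<gamma>1 t \<noteq> \<gamma>2 s \<and> W s t \<noteq> 0 \<and>
    A s t * (X $ 1 - M1 s t) + B s t * (X $ 2 - M2 s t) = 0 \<and>
    A_s s t * (X $ 1 - M1 s t) + B_s s t * (X $ 2 - M2 s t) = \<alpha> * (1 - \<alpha>) * Q s t * W s t \<and>
    A_t s t * (X $ 1 - M1 s t) + B_t s t * (X $ 2 - M2 s t) = - (\<alpha> * (1 - \<alpha>) * P s t * W s t)"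
proof -
  have "nonparallel_tangents \<gamma>1 \<gamma>2 s t \<longleftrightarrow> W s t \<noteq> 0"
    using assms by (simp add: nonparallel_tangents_def vector_derivative_\<gamma>1 vector_derivative_\<gamma>2
        bracket_eq W_def)
  then show ?thesis
    unfolding AEIL_point_def Let_def F_eq[OF assms] D_s_F[OF assms] D_t_F[OF assms] by auto
qed

section \<open>Solving for the envelope point\<close>

definition "L s t = - (1 - \<alpha>) * Q s t * W s t / S s t"

text \<open>Cramer's rule with determinant \<open>\<alpha> * S\<close> solves the first two
  equations; the third is then the solvability condition.\<close>

lemma AEIL_point_unique:
  assumes st: "\<bar>s\<bar> < e" "\<bar>t\<bar> < e" and "\<gamma>1 t \<noteq> \<gamma>2 s" "W s t \<noteq> 0" "\<Phi> s t = 0" "S s t \<noteq> 0"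
  shows "AEIL_point \<alpha> \<gamma>1 \<gamma>2 s t X \<longleftrightarrow> X = vector [M1 s t + L s t * B s t, M2 s t - L s t * A s t]"
proof -
  have L: "L s t * S s t = - (1 - \<alpha>) * Q s t * W s t" using assms(6) by (simp add: L_def)
  have fwd: "x = L s t * B s t \<and> y = - L s t * A s t"
    if "A s t * x + B s t * y = 0" "A_s s t * x + B_s s t * y = \<alpha> * (1 - \<alpha>) * Q s t * W s t" for x y
  proof -
    have "(A s t * B_s s t - B s t * A_s s t) * x = - B s t * (\<alpha> * (1 - \<alpha>) * Q s t * W s t)"
      using that by algebra
    then have "(\<alpha> * S s t) * x = (\<alpha> * S s t) * (L s t * B s t)"
      using L unfolding cross_s by algebra
    moreover have "(A s t * B_s s t - B s t * A_s s t) * y = A s t * (\<alpha> * (1 - \<alpha>) * Q s t * W s t)"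
      using that by algebra
    then have "(\<alpha> * S s t) * y = (\<alpha> * S s t) * (- L s t * A s t)"
      using L unfolding cross_s by algebra
    moreover have "\<alpha> * S s t \<noteq> 0" using assms(6) \<alpha> by simp
    ultimately show ?thesis by (metis mult_left_cancel)
  qed
  have s: "A_s s t * (L s t * B s t) + B_s s t * (- L s t * A s t) = \<alpha> * (1 - \<alpha>) * Q s t * W s t"
    using L cross_s[of s t] by algebra
  have t: "A_t s t * (L s t * B s t) + B_t s t * (- L s t * A s t) = - (\<alpha> * (1 - \<alpha>) * P s t * W s t)"
  proof -
    \<comment> \<open>Multiplication by \<open>S\<close> clears the denominator of \<open>L\<close>;
      the defect of the third equation is then a multiple of \<open>\<Phi>\<close>.\<close>
    have "(A_t s t * (L s t * B s t) + B_t s t * (- L s t * A s t)) * S s t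
      = - (\<alpha> * (1 - \<alpha>) * P s t * W s t) * S s t + (1 - \<alpha>) * W s t * \<Phi> s t"
      using L cross_t[of s t] unfolding \<Phi>_def S_def by algebra
    then show ?thesis using assms(5,6) by (metis add.right_neutral mult_right_cancel mult_zero_right)
  qed
  show ?thesis
  proof
    assume "AEIL_point \<alpha> \<gamma>1 \<gamma>2 s t X"
    then have "X $ 1 - M1 s t = L s t * B s t \<and> X $ 2 - M2 s t = - L s t * A s t"
      unfolding AEIL_point_iff[OF st] by (intro fwd) auto
    then show "X = vector [M1 s t + L s t * B s t, M2 s t - L s t * A s t]"
      unfolding vec_2_eq_vector_iff by auto
  next
    assume "X = vector [M1 s t + L s t * B s t, M2 s t - L s t * A s t]"
    then have X: "X $ 1 - M1 s t = L s t * B s t" "X $ 2 - M2 s t = - L s t * A s t" by simp_all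
    have "A s t * (L s t * B s t) + B s t * (- L s t * A s t) = 0" by algebra
    then show "AEIL_point \<alpha> \<gamma>1 \<gamma>2 s t X"
      unfolding AEIL_point_iff[OF st] X using assms(3,4) s t by blast
  qed
qed

text \<open>With \<open>S = 0\<close> the rows of \<open>F\<close> and \<open>F_s\<close> are
  proportional, but their right-hand sides \<open>0\<close> and
  \<open>\<alpha> * (1 - \<alpha>) * Q * W\<close> are not compatible.\<close>

lemma no_AEIL_point:
  assumes "\<bar>s\<bar> < e" "\<bar>t\<bar> < e" "Q s t \<noteq> 0" "B s t \<noteq> 0" "S s t = 0"
  shows "\<not> AEIL_point \<alpha> \<gamma>1 \<gamma>2 s t X"
proof
  assume "AEIL_point \<alpha> \<gamma>1 \<gamma>2 s t X"
  then have W: "W s t \<noteq> 0"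
    and "A s t * (X $ 1 - M1 s t) + B s t * (X $ 2 - M2 s t) = 0"
    and "A_s s t * (X $ 1 - M1 s t) + B_s s t * (X $ 2 - M2 s t) = \<alpha> * (1 - \<alpha>) * Q s t * W s t"
    unfolding AEIL_point_iff[OF assms(1,2)] by auto
  moreover from assms(5) have "A s t * B_s s t = B s t * A_s s t" using cross_s[of s t] by simp
  ultimately have "B s t * (\<alpha> * (1 - \<alpha>) * Q s t * W s t) = 0" by algebra
  with W assms \<alpha> show False by simp
qed

end

subsection \<open>The curve of contributing pairs\<close>

lemma isCont_eventually_neq:
  fixes \<phi> :: "'a::t2_space \<Rightarrow> 'b::t1_space"
  assumes "isCont \<phi> z" "\<phi> z \<noteq> c"
  shows "\<forall>\<^sub>F w in nhds z. \<phi> w \<noteq> c"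
  using assms unfolding isCont_def tendsto_at_iff_tendsto_nhds
  by (rule tendsto_imp_eventually_ne)

lemma has_derivative_fst_compose:
  assumes "(\<phi> has_real_derivative D) (at (fst z))"
  shows "((\<lambda>z :: real \<times> real. \<phi> (fst z)) has_derivative (\<lambda>h. D * fst h)) (at z)"
  using has_derivative_compose[OF has_derivative_fst[OF has_derivative_ident], of \<phi> "(*) D" z UNIV] assms
  by (simp add: has_field_derivative_def)

lemma has_derivative_snd_compose:
  assumes "(\<phi> has_real_derivative D) (at (snd z))"
  shows "((\<lambda>z :: real \<times> real. \<phi> (snd z)) has_derivative (\<lambda>h. D * snd h)) (at z)"
  using has_derivative_compose[OF has_derivative_snd[OF has_derivative_ident], of \<phi> "(*) D" z UNIV] assms
  by (simp add: has_field_derivative_def)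

context graph_pair
begin

lemma times_differentiable_on_fg:
  "times_differentiable_on n {-e<..<e} f" "times_differentiable_on n {-e<..<e} f1"
  "times_differentiable_on n {-e<..<e} f2" "times_differentiable_on n {-e<..<e} g"
  "times_differentiable_on n {-e<..<e} g1" "times_differentiable_on n {-e<..<e} g2"
proof -
  have f2: "times_differentiable_on (Suc n) {-e<..<e} f2" for n
    by (rule times_differentiable_on_SucI[OF f(3) smooth(1)]) auto
  have f1: "times_differentiable_on (Suc n) {-e<..<e} f1" for n
    by (rule times_differentiable_on_SucI[OF f(2) times_differentiable_on_SucD[OF f2]]) auto
  have f0: "times_differentiable_on (Suc n) {-e<..<e} f" for n
    by (rule times_differentiable_on_SucI[OF f(1) times_differentiable_on_SucD[OF f1]]) auto
  have g2: "times_differentiable_on (Suc n) {-e<..<e} g2" for n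
    by (rule times_differentiable_on_SucI[OF g(3) smooth(2)]) auto
  have g1: "times_differentiable_on (Suc n) {-e<..<e} g1" for n
    by (rule times_differentiable_on_SucI[OF g(2) times_differentiable_on_SucD[OF g2]]) auto
  have g0: "times_differentiable_on (Suc n) {-e<..<e} g" for n
    by (rule times_differentiable_on_SucI[OF g(1) times_differentiable_on_SucD[OF g1]]) auto
  show "times_differentiable_on n {-e<..<e} f" "times_differentiable_on n {-e<..<e} f1"
    "times_differentiable_on n {-e<..<e} f2" "times_differentiable_on n {-e<..<e} g"
    "times_differentiable_on n {-e<..<e} g1" "times_differentiable_on n {-e<..<e} g2"
    by (rule times_differentiable_on_SucD, fact)+
qed

lemma isCont_fg:
  assumes "\<bar>x\<bar> < e"
  shows "isCont f x" "isCont f1 x" "isCont f2 x" "isCont f3 x"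
    "isCont g x" "isCont g1 x" "isCont g2 x" "isCont g3 x"
proof -
  have "isCont h x" if "\<And>n. times_differentiable_on n {-e<..<e} h" for h
    using times_differentiable_on_DERIV[OF that[of "Suc 0"], of x] assms
    by (auto simp: abs_less_iff intro: DERIV_isCont)
  then show "isCont f x" "isCont f1 x" "isCont f2 x" "isCont f3 x"
    "isCont g x" "isCont g1 x" "isCont g2 x" "isCont g3 x"
    using times_differentiable_on_fg smooth by blast+
qed

definition "\<Phi>_s s t = (1 - \<alpha>) * (3 * Q s t ^ 2 * (- g2 s * (s - t)) * f2 t)
  + \<alpha> * (3 * P s t ^ 2 * W s t * g2 s + P s t ^ 3 * g3 s)"

definition "\<Phi>_t s t = (1 - \<alpha>) * (3 * Q s t ^ 2 * W s t * f2 t + Q s t ^ 3 * f3 t)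
  + \<alpha> * (3 * P s t ^ 2 * (- f2 t * (s - t)) * g2 s)"

abbreviation "U \<equiv> {-e<..<e} \<times> {-e<..<e}"

lemma continuous_on_U:
  "continuous_on U (\<lambda>z. W (fst z) (snd z))"
  "continuous_on U (\<lambda>z. S (fst z) (snd z))"
  "continuous_on U (\<lambda>z. \<Phi>_s (fst z) (snd z))"
  "continuous_on U (\<lambda>z. \<Phi>_t (fst z) (snd z))"
proof -
  have I: "continuous_on U (\<lambda>z. h (fst z))" "continuous_on U (\<lambda>z. h (snd z))"
    if "\<And>x. \<bar>x\<bar> < e \<Longrightarrow> isCont h x" for h :: "real \<Rightarrow> real"
  proof -
    have c: "continuous_on {-e<..<e} h"
      using that by (intro continuous_at_imp_continuous_on) auto
    show "continuous_on U (\<lambda>z. h (fst z))" "continuous_on U (\<lambda>z. h (snd z))"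
      by (rule continuous_on_compose2[OF c], auto intro!: continuous_intros)+
  qed
  note C = I(2)[OF isCont_fg(1)] I(2)[OF isCont_fg(2)] I(2)[OF isCont_fg(3)] I(2)[OF isCont_fg(4)]
    I(1)[OF isCont_fg(5)] I(1)[OF isCont_fg(6)] I(1)[OF isCont_fg(7)] I(1)[OF isCont_fg(8)]
  show "continuous_on U (\<lambda>z. W (fst z) (snd z))"
    "continuous_on U (\<lambda>z. S (fst z) (snd z))"
    "continuous_on U (\<lambda>z. \<Phi>_s (fst z) (snd z))"
    "continuous_on U (\<lambda>z. \<Phi>_t (fst z) (snd z))"
    unfolding \<Phi>_s_def \<Phi>_t_def S_def W_def P_def Q_def
    by (intro continuous_intros C; assumption)+
qed

lemma open_U: "open U" "(0, 0) \<in> U"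
  using e by (auto intro: open_Times)

lemma isCont_W_S_0:
  "isCont (\<lambda>z. W (fst z) (snd z)) (0, 0)" "isCont (\<lambda>z. S (fst z) (snd z)) (0, 0)"
  using continuous_on_U(1,2) open_U continuous_on_eq_continuous_at by blast+

lemma has_derivative_\<Phi>:
  assumes "z \<in> U"
  shows "((\<lambda>z. \<Phi> (fst z) (snd z)) has_derivative
    (\<lambda>h. \<Phi>_s (fst z) (snd z) * fst h + \<Phi>_t (fst z) (snd z) * snd h)) (at z)"
proof -
  obtain s t where z: "z = (s, t)" "\<bar>s\<bar> < e" "\<bar>t\<bar> < e" using assms by (cases z) auto
  then have [simp]: "fst z = s" "snd z = t" by simp_all
  have I: "((\<lambda>z. f (snd z)) has_derivative (\<lambda>h. f1 t * snd h)) (at z)"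
    "((\<lambda>z. f1 (snd z)) has_derivative (\<lambda>h. f2 t * snd h)) (at z)"
    "((\<lambda>z. f2 (snd z)) has_derivative (\<lambda>h. f3 t * snd h)) (at z)"
    "((\<lambda>z. g (fst z)) has_derivative (\<lambda>h. g1 s * fst h)) (at z)"
    "((\<lambda>z. g1 (fst z)) has_derivative (\<lambda>h. g2 s * fst h)) (at z)"
    "((\<lambda>z. g2 (fst z)) has_derivative (\<lambda>h. g3 s * fst h)) (at z)"
    using z(2,3) by (auto intro!: has_derivative_snd_compose has_derivative_fst_compose f g)
  have W: "((\<lambda>z. W (fst z) (snd z)) has_derivative (\<lambda>h. g2 s * fst h - f2 t * snd h)) (at z)"
    unfolding W_def by (auto intro!: derivative_eq_intros I)
  have P: "((\<lambda>z. P (fst z) (snd z)) has_derivative (\<lambda>h. W s t * fst h - f2 t * (s - t) * snd h)) (at z)"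
    unfolding P_def by (auto intro!: derivative_eq_intros I simp: W_def algebra_simps)
  have Q: "((\<lambda>z. Q (fst z) (snd z)) has_derivative (\<lambda>h. - g2 s * (s - t) * fst h + W s t * snd h)) (at z)"
    unfolding Q_def by (auto intro!: derivative_eq_intros I simp: W_def algebra_simps)
  show ?thesis
    unfolding \<Phi>_def
    by (rule derivative_eq_intros P Q I(3,6) refl)+
       (auto simp: \<Phi>_s_def \<Phi>_t_def fun_eq_iff eval_nat_numeral algebra_simps)
qed

lemma exists_contributing_curve:
  assumes "\<Phi> 0 0 = 0" "\<Phi>_t 0 0 \<noteq> 0" "W 0 0 \<noteq> 0"
  shows "\<exists>\<tau>. contributing_curve \<alpha> \<gamma>1 \<gamma>2 \<tau>"
proof -
  obtain \<tau> d where \<tau>: "d > 0" "\<tau> 0 = 0"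
    "\<forall>s. \<bar>s\<bar> < d \<longrightarrow> (s, \<tau> s) \<in> U \<and> \<Phi>_t s (\<tau> s) \<noteq> 0 \<and>
       (\<tau> has_real_derivative - \<Phi>_s s (\<tau> s) / \<Phi>_t s (\<tau> s)) (at s)"
    "\<forall>\<^sub>F z in nhds (0, 0). \<Phi> (fst z) (snd z) = 0 \<longleftrightarrow> snd z = \<tau> (fst z)"
    by (rule implicit_function[OF open_U has_derivative_\<Phi> continuous_on_U(3,4), unfolded fst_conv snd_conv, OF _ assms(1,2)])
  define I where "I = {-d<..<d}"
  have I: "I \<subseteq> {-e<..<e}" "\<And>s. s \<in> I \<Longrightarrow> \<tau> s \<in> {-e<..<e}" using \<tau>(3) by (force simp: I_def)+
  have "times_differentiable_on n I \<tau>" for n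
  \<comment> \<open>Bootstrapping: \<open>\<tau>' = - \<Phi>_s / \<Phi>_t\<close> along the curve is
    as often differentiable as \<open>\<tau>\<close>, which gains one order.\<close>
  proof (induction n)
    case (Suc n)
    note C = times_differentiable_on_compose[OF _ Suc I(2)]
    note F = C[OF times_differentiable_on_fg(1)] C[OF times_differentiable_on_fg(2)]
      C[OF times_differentiable_on_fg(3)] C[OF smooth(1)]
    note G = times_differentiable_on_subset[OF _ I(1)]
    note G = G[OF times_differentiable_on_fg(4)] G[OF times_differentiable_on_fg(5)]
      G[OF times_differentiable_on_fg(6)] G[OF smooth(2)]
    have "times_differentiable_on n I (\<lambda>s. (0 - \<Phi>_s s (\<tau> s)) / \<Phi>_t s (\<tau> s))"
    proof (rule times_differentiable_on_divide)
      show "times_differentiable_on n I (\<lambda>s. 0 - \<Phi>_s s (\<tau> s))"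
        \<comment> \<open>The last two rewrites turn negated products into differences from
          \<open>0\<close>, to which the closure rules apply.\<close>
        unfolding \<Phi>_s_def W_def P_def Q_def minus_mult_left[symmetric] diff_0[symmetric]
        by (intro times_differentiable_on_add times_differentiable_on_diff times_differentiable_on_mult
            times_differentiable_on_power times_differentiable_on_const times_differentiable_on_ident Suc F G; assumption)
      show "times_differentiable_on n I (\<lambda>s. \<Phi>_t s (\<tau> s))"
        unfolding \<Phi>_t_def W_def P_def Q_def minus_mult_left[symmetric] diff_0[symmetric]
        by (intro times_differentiable_on_add times_differentiable_on_diff times_differentiable_on_mult
            times_differentiable_on_power times_differentiable_on_const times_differentiable_on_ident Suc F G; assumption)
    qed (use \<tau>(3) in \<open>auto simp: I_def\<close>)
    then show ?case
      by (rule times_differentiable_on_SucI[rotated]) (use \<tau>(3) in \<open>auto simp: I_def\<close>)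
  qed simp
  then have "smooth_on I \<tau>"
    by (intro times_differentiable_on_smooth_on) (simp_all add: I_def)
  \<comment> \<open>Since \<open>W\<close> stays nonzero near the origin, contributing there means
    \<open>\<Phi> = 0\<close>.\<close>
  moreover have "\<forall>\<^sub>F z in nhds (0, 0). contributes \<alpha> \<gamma>1 \<gamma>2 (fst z) (snd z) \<longleftrightarrow> snd z = \<tau> (fst z)"
    using \<tau>(4) isCont_eventually_neq[OF isCont_W_S_0(1), of 0, simplified, OF assms(3)]
      eventually_nhds_in_open[OF open_U]
    by eventually_elim (auto simp: contributes_iff)
  ultimately show ?thesis
    unfolding contributing_curve_def case_prod_unfold using \<tau>(1,2) I_def by blast
qed

section \<open>The envelope along an arbitrary contributing curve\<close>

context
  fixes \<tau>
  assumes \<tau>: "contributing_curve \<alpha> \<gamma>1 \<gamma>2 \<tau>" and W0: "W 0 0 \<noteq> 0"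
begin

lemma curve_0: "\<tau> 0 = 0"
  using \<tau> by (simp add: contributing_curve_def)

lemma curve_DERIV: "(\<tau> has_real_derivative deriv \<tau> 0) (at 0)"
proof -
  obtain \<epsilon> where "\<epsilon> > 0" "smooth_on {-\<epsilon><..<\<epsilon>} \<tau>" using \<tau> by (auto simp: contributing_curve_def)
  then show ?thesis
    using times_differentiable_on_DERIV[OF smooth_on_times_differentiable_on] by simp
qed

text \<open>Transfers what holds for all pairs near \<open>(0, 0)\<close> to the pairs
  \<open>(s, \<tau> s)\<close> with \<open>s\<close> near \<open>0\<close>.\<close>

lemma filterlim_curve: "filterlim (\<lambda>s. (s, \<tau> s)) (nhds (0, 0)) (nhds 0)"
proof -
  have "isCont (\<lambda>s. (s, \<tau> s)) 0"
    using DERIV_isCont[OF curve_DERIV] by (intro continuous_intros)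
  then show ?thesis using tendsto_at_iff_tendsto_nhds[of "\<lambda>s. (s, \<tau> s)" 0] by (simp add: isCont_def curve_0)
qed

lemma eventually_curve:
  "\<forall>\<^sub>F s in nhds 0. \<bar>s\<bar> < e \<and> \<bar>\<tau> s\<bar> < e \<and> W s (\<tau> s) \<noteq> 0 \<and> \<Phi> s (\<tau> s) = 0"
proof -
  have "\<forall>\<^sub>F z in nhds (0, 0). contributes \<alpha> \<gamma>1 \<gamma>2 (fst z) (snd z) \<longleftrightarrow> snd z = \<tau> (fst z)"
    using \<tau> by (simp add: contributing_curve_def case_prod_unfold)
  then have "\<forall>\<^sub>F z in nhds (0, 0). z \<in> U \<and> W (fst z) (snd z) \<noteq> 0 \<and>
      (snd z = \<tau> (fst z) \<longrightarrow> \<Phi> (fst z) (snd z) = 0)"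
    using isCont_eventually_neq[OF isCont_W_S_0(1), of 0, simplified, OF W0]
      eventually_nhds_in_open[OF open_U]
    by eventually_elim (auto simp: contributes_iff)
  from eventually_compose_filterlim[OF this filterlim_curve] show ?thesis
    by eventually_elim auto
qed

text \<open>The curve is given only by its defining property, so its slope is found by
  differentiating \<open>\<Phi> s (\<tau> s) = 0\<close>, valid near \<open>0\<close>.\<close>

lemma curve_deriv:
  assumes "\<Phi>_t 0 0 \<noteq> 0"
  shows "deriv \<tau> 0 = - \<Phi>_s 0 0 / \<Phi>_t 0 0"
proof -
  define D where "D = deriv \<tau> 0"
  have "(\<tau> has_derivative (\<lambda>h. D * h)) (at 0)"
    using curve_DERIV by (simp add: has_field_derivative_def D_def)
  then have "((\<lambda>s. (s, \<tau> s)) has_derivative (\<lambda>h. (h, D * h))) (at 0)"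
    by (auto intro!: derivative_eq_intros)
  from has_derivative_compose[where f = "\<lambda>s. (s, \<tau> s)" and g = "\<lambda>z. \<Phi> (fst z) (snd z)",
      OF this has_derivative_\<Phi>] open_U(2)
  have 1: "((\<lambda>s. \<Phi> s (\<tau> s)) has_derivative (\<lambda>h. \<Phi>_s 0 0 * h + \<Phi>_t 0 0 * (D * h))) (at 0)"
    by (simp add: curve_0)
  have ev: "\<forall>\<^sub>F s in nhds 0. \<Phi> s (\<tau> s) = 0" using eventually_curve by eventually_elim auto
  from ev obtain T where T: "open T" "0 \<in> T" "\<And>s. s \<in> T \<Longrightarrow> \<Phi> s (\<tau> s) = 0"
    unfolding eventually_nhds by blast
  have "((\<lambda>s. \<Phi> s (\<tau> s)) has_derivative (\<lambda>h. 0)) (at 0)"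
    by (rule has_derivative_transform_within_open[OF has_derivative_const T(1,2)]) (simp add: T(3))
  from fun_cong[OF has_derivative_unique[OF 1 this], of 1] assms
  show ?thesis unfolding D_def by (simp add: field_simps)
qed

text \<open>The envelope point is unique for \<open>s\<close> near \<open>0\<close>, so every
  admissible parametrization has the germ of the explicit one, whose velocity at \<open>0\<close> is
  \<open>(x', y')\<close>.\<close>

lemma AEIL_regular_iff:
  assumes fg0: "f 0 \<noteq> g 0" and S0: "S 0 0 \<noteq> 0"
    and x: "((\<lambda>s. M1 s (\<tau> s) + L s (\<tau> s) * B s (\<tau> s)) has_real_derivative x') (at 0)"
    and y: "((\<lambda>s. M2 s (\<tau> s) - L s (\<tau> s) * A s (\<tau> s)) has_real_derivative y') (at 0)"
  shows "AEIL_regular_at_0 \<alpha> \<gamma>1 \<gamma>2 \<tau> \<longleftrightarrow> x' \<noteq> 0 \<or> y' \<noteq> 0"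
proof -
  define X where "X = (\<lambda>s. vector [M1 s (\<tau> s) + L s (\<tau> s) * B s (\<tau> s),
    M2 s (\<tau> s) - L s (\<tau> s) * A s (\<tau> s)] :: real^2)"
  have X': "(X has_vector_derivative vector [x', y']) (at 0)"
    unfolding X_def by (rule has_vector_derivative_vector_2[OF x y])
  have "isCont (\<lambda>z. f (snd z) - g (fst z)) (0, 0)"
    using e f(1)[of 0] g(1)[of 0] by (intro has_derivative_continuous[of _ "\<lambda>h. f1 0 * snd h - g1 0 * fst h"]
        has_derivative_diff has_derivative_snd_compose has_derivative_fst_compose) auto
  from isCont_eventually_neq[OF this, of 0] fg0 isCont_eventually_neq[OF isCont_W_S_0(2), of 0] S0
  have "\<forall>\<^sub>F z in nhds (0, 0). f (snd z) - g (fst z) \<noteq> 0 \<and> S (fst z) (snd z) \<noteq> 0"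
    by (simp add: eventually_conj_iff)
  from eventually_compose_filterlim[OF this filterlim_curve] eventually_curve
  have ev: "\<forall>\<^sub>F s in nhds 0. \<forall>Y. AEIL_point \<alpha> \<gamma>1 \<gamma>2 s (\<tau> s) Y \<longleftrightarrow> Y = X s"
  proof eventually_elim
    case (elim s)
    \<comment> \<open>Different ordinates keep the two points of the pair distinct.\<close>
    have "s = \<tau> s \<longrightarrow> f (\<tau> s) \<noteq> g s" using elim by auto
    then show ?case using elim unfolding X_def
      by (auto simp: AEIL_point_unique vector_2_eq_iff)
  qed
  show ?thesis
  proof
    assume "AEIL_regular_at_0 \<alpha> \<gamma>1 \<gamma>2 \<tau>"
    then obtain Z where Z: "\<forall>\<^sub>F s in nhds 0. \<forall>Y. AEIL_point \<alpha> \<gamma>1 \<gamma>2 s (\<tau> s) Y \<longleftrightarrow> Y = Z s"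
      "Z differentiable (at 0)" "vector_derivative Z (at 0) \<noteq> 0"
      by (auto simp: AEIL_regular_at_0_def)
    from ev Z(1) have "\<forall>\<^sub>F s in nhds 0. X s = Z s" by eventually_elim metis
    then have "vector_derivative X (at 0) = vector_derivative Z (at 0)"
      by (intro vector_derivative_cong_eq) auto
    with Z(3) vector_derivative_at[OF X'] show "x' \<noteq> 0 \<or> y' \<noteq> 0"
      by (auto simp: vec_eq_iff forall_2)
  next
    assume "x' \<noteq> 0 \<or> y' \<noteq> 0"
    then have "vector_derivative X (at 0) \<noteq> 0"
      unfolding vector_derivative_at[OF X'] by (auto simp: vec_eq_iff forall_2)
    moreover have "X differentiable (at 0)" using X' by (rule differentiableI_vector)
    ultimately show "AEIL_regular_at_0 \<alpha> \<gamma>1 \<gamma>2 \<tau>"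
      unfolding AEIL_regular_at_0_def using ev by blast
  qed
qed

text \<open>A neighbourhood of \<open>0\<close> contains \<open>0\<close> itself, so regularity
  would supply an envelope point at the pair \<open>(0, 0)\<close>, where \<open>P\<close>,
  \<open>Q\<close> and \<open>B\<close> all equal \<open>g 0 - f 0\<close>.\<close>

lemma not_AEIL_regular:
  assumes "f 0 \<noteq> g 0" "S 0 0 = 0"
  shows "\<not> AEIL_regular_at_0 \<alpha> \<gamma>1 \<gamma>2 \<tau>"
proof
  assume "AEIL_regular_at_0 \<alpha> \<gamma>1 \<gamma>2 \<tau>"
  then obtain Z where "\<forall>\<^sub>F s in nhds 0. \<forall>Y. AEIL_point \<alpha> \<gamma>1 \<gamma>2 s (\<tau> s) Y \<longleftrightarrow> Y = Z s"
    by (auto simp: AEIL_regular_at_0_def)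
  from eventually_nhds_x_imp_x[OF this] have "AEIL_point \<alpha> \<gamma>1 \<gamma>2 0 0 (Z 0)"
    by (simp add: curve_0)
  moreover have "Q 0 0 \<noteq> 0" "B 0 0 \<noteq> 0"
    using assms(1) by (auto simp: Q_def B_def P_def algebra_simps)
  ultimately show False using no_AEIL_point[of 0 0] e assms(2) by auto
qed

text \<open>Here \<open>p\<close> is the slope of the contributing curve, \<open>l\<close> and
  \<open>l'\<close> are the value and the derivative of \<open>L\<close> along it at
  \<open>0\<close>, and \<open>S'\<close> is the derivative of \<open>S\<close>. At
  \<open>s = t\<close> the terms of the derivatives of \<open>P\<close> and \<open>Q\<close> with
  factor \<open>s - t\<close> vanish.\<close>

lemma curve_DERIV_intermediate:
  assumes f0: "f 0 = 0" "f1 0 = 0" and S0: "S 0 0 \<noteq> 0"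
  defines "p \<equiv> deriv \<tau> 0" and "l \<equiv> - (1 - \<alpha>) * g 0 * g1 0 / S 0 0"
  defines "S' \<equiv> (1 - \<alpha>) * (g1 0 * p * (g1 0)\<^sup>2 + 2 * g 0 * g1 0 * (g2 0 - f2 0 * p))
      + 2 * g 0 * g1 0 * g2 0 + (g 0)\<^sup>2 * g3 0"
  defines "l' \<equiv> - (1 - \<alpha>) * ((g1 0 * p * g1 0 + g 0 * (g2 0 - f2 0 * p)) * S 0 0 - g 0 * g1 0 * S') / (S 0 0)\<^sup>2"
  shows "((\<lambda>s. M1 s (\<tau> s) + L s (\<tau> s) * B s (\<tau> s)) has_real_derivative
      (1 - \<alpha>) * p + \<alpha> + l' * g 0 + l * ((1 - \<alpha>) * g1 0 * p + \<alpha> * g1 0)) (at 0)"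
    "((\<lambda>s. M2 s (\<tau> s) - L s (\<tau> s) * A s (\<tau> s)) has_real_derivative
      \<alpha> * g1 0 + l' * (\<alpha> * g 0 * g1 0) + l * ((1 - \<alpha>) * g 0 * f2 0 * p + \<alpha> * ((g1 0)\<^sup>2 + g 0 * g2 0))) (at 0)"
proof -
  have \<tau>': "(\<tau> has_real_derivative p) (at 0)" unfolding p_def by (rule curve_DERIV)
  have C: "((\<lambda>s. h (\<tau> s)) has_real_derivative h' * p) (at 0)" if "(h has_real_derivative h') (at 0)" for h h'
    using DERIV_chain2[of h h' \<tau> 0 p UNIV] that \<tau>' curve_0 by simp
  note I = C[OF f(1)[of 0]] C[OF f(2)[of 0]] C[OF f(3)[of 0]] g[of 0] \<tau>'
  have W: "((\<lambda>s. W s (\<tau> s)) has_real_derivative g2 0 - f2 0 * p) (at 0)"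
    unfolding W_def using e by (auto intro!: derivative_eq_intros I simp: curve_0 f0)
  have P: "((\<lambda>s. P s (\<tau> s)) has_real_derivative g1 0) (at 0)"
    unfolding P_def using e by (auto intro!: derivative_eq_intros I simp: curve_0 f0)
  have Q: "((\<lambda>s. Q s (\<tau> s)) has_real_derivative g1 0 * p) (at 0)"
    unfolding Q_def using e by (auto intro!: derivative_eq_intros I simp: curve_0 f0 algebra_simps)
  have v: "W 0 0 = g1 0" "P 0 0 = g 0" "Q 0 0 = g 0" by (simp_all add: W_def P_def Q_def f0)
  have g2: "(g2 has_real_derivative g3 0) (at 0)" using g(3)[of 0] e by simp
  have S: "((\<lambda>s. S s (\<tau> s)) has_real_derivative S') (at 0)"
    unfolding S_def S'_def
    by (auto intro!: derivative_eq_intros W P Q g2 simp: curve_0 v algebra_simps power2_eq_square)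
  have L: "((\<lambda>s. L s (\<tau> s)) has_real_derivative l') (at 0)"
    unfolding L_def l'_def using S0
    by (auto intro!: derivative_eq_intros W Q S simp: curve_0 v algebra_simps power2_eq_square)
  have L0: "L 0 0 = l" by (simp add: L_def l_def v)
  have B: "((\<lambda>s. B s (\<tau> s)) has_real_derivative (1 - \<alpha>) * g1 0 * p + \<alpha> * g1 0) (at 0)"
    unfolding B_def by (auto intro!: derivative_eq_intros P Q)
  have A: "((\<lambda>s. A s (\<tau> s)) has_real_derivative
      - ((1 - \<alpha>) * g 0 * f2 0 * p + \<alpha> * ((g1 0)\<^sup>2 + g 0 * g2 0))) (at 0)"
    unfolding A_def using e
    by (auto intro!: derivative_eq_intros P Q I simp: curve_0 f0 v algebra_simps power2_eq_square)
  have M1: "((\<lambda>s. M1 s (\<tau> s)) has_real_derivative (1 - \<alpha>) * p + \<alpha>) (at 0)"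
    unfolding M1_def by (auto intro!: derivative_eq_intros I)
  have M2: "((\<lambda>s. M2 s (\<tau> s)) has_real_derivative \<alpha> * g1 0) (at 0)"
    unfolding M2_def using e by (auto intro!: derivative_eq_intros I simp: f0)
  have AB0: "A 0 0 = - \<alpha> * g 0 * g1 0" "B 0 0 = g 0"
    by (simp_all add: A_def B_def v f0 algebra_simps)
  show "((\<lambda>s. M1 s (\<tau> s) + L s (\<tau> s) * B s (\<tau> s)) has_real_derivative
      (1 - \<alpha>) * p + \<alpha> + l' * g 0 + l * ((1 - \<alpha>) * g1 0 * p + \<alpha> * g1 0)) (at 0)"
    by (auto intro!: derivative_eq_intros M1 L B simp: curve_0 L0 AB0)
  show "((\<lambda>s. M2 s (\<tau> s) - L s (\<tau> s) * A s (\<tau> s)) has_real_derivative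
      \<alpha> * g1 0 + l' * (\<alpha> * g 0 * g1 0) + l * ((1 - \<alpha>) * g 0 * f2 0 * p + \<alpha> * ((g1 0)\<^sup>2 + g 0 * g2 0))) (at 0)"
    by (auto intro!: derivative_eq_intros M2 L A simp: curve_0 L0 AB0 algebra_simps)
qed

end

end

subsection \<open>Regularity\<close>

lemma smooth_on_component:
  fixes c :: "real \<Rightarrow> real^'n"
  assumes "smooth_on S c"
  shows "times_differentiable_on n S (\<lambda>u. c u $ i)"
  using assms
proof (induction n arbitrary: c)
  case (Suc n)
  let ?c' = "\<lambda>u. vector_derivative c (at u)"
  have "smooth_on S ?c'"
    using Suc.prems unfolding smooth_on_def nth_deriv_Suc'[symmetric] by blast
  then have "times_differentiable_on n S (\<lambda>u. ?c' u $ i)" by (rule Suc.IH)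
  moreover have "((\<lambda>u. c u $ i) has_real_derivative ?c' x $ i) (at x)" if "x \<in> S" for x
  proof -
    have "(c has_vector_derivative ?c' x) (at x)"
      using Suc.prems that unfolding smooth_on_def by (metis nth_deriv_0 vector_derivative_works)
    from bounded_linear.has_vector_derivative[OF bounded_linear_vec_nth this] show ?thesis
      by (simp add: has_real_derivative_iff_has_vector_derivative)
  qed
  ultimately show ?case by (rule times_differentiable_on_SucI[rotated])
qed simp

text \<open>Near \<open>0\<close> the function \<open>h\<close> is the second coordinate of
  \<open>\<gamma> \<circ> \<phi>\<close>, and both factors are smooth.\<close>

lemma local_parametrization_graph:
  assumes "smooth_closed_curve \<gamma>" "local_parametrization \<gamma> p (\<lambda>t. vector [t, h t])"
  obtains e where "e > 0" "\<forall>n. times_differentiable_on n {-e<..<e} h"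
proof -
  obtain \<epsilon> \<phi> where \<phi>: "\<epsilon> > 0" "smooth_on {-\<epsilon><..<\<epsilon>} \<phi>"
    "\<And>v. v \<in> {-\<epsilon><..<\<epsilon>} \<Longrightarrow> vector [v, h v] = \<gamma> (\<phi> v)"
    using assms(2) unfolding local_parametrization_def by blast
  have \<gamma>: "times_differentiable_on n UNIV (\<lambda>u. \<gamma> u $ 2)" for n
    using assms(1) by (intro smooth_on_component) (simp add: smooth_closed_curve_def)
  have "times_differentiable_on n {-\<epsilon><..<\<epsilon>} h" for n
  proof (rule times_differentiable_on_cong)
    show "times_differentiable_on n {-\<epsilon><..<\<epsilon>} (\<lambda>v. \<gamma> (\<phi> v) $ 2)"
      by (rule times_differentiable_on_compose[OF \<gamma> smooth_on_times_differentiable_on[OF \<phi>(2)]]) simp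
    show "\<gamma> (\<phi> v) $ 2 = h v" if "v \<in> {-\<epsilon><..<\<epsilon>}" for v
      by (simp flip: \<phi>(3)[OF that])
  qed simp
  with that \<phi>(1) show ?thesis by blast
qed

lemma vector_derivative_transform_open:
  assumes "open S" "x \<in> S" "\<And>y. y \<in> S \<Longrightarrow> c y = d y" "(d has_vector_derivative d') (at x)"
  shows "vector_derivative c (at x) = d'"
  using has_vector_derivative_transform_within_open[OF assms(4,1,2)] assms(3) by (auto intro: vector_derivative_at)

section \<open>Values at the origin and the two regularity criteria\<close>

context graph_pair
begin

lemma ordinary_inflection_at_\<gamma>2:
  "ordinary_inflection_at \<gamma>2 0 \<longleftrightarrow> g2 0 = 0 \<and> g3 0 \<noteq> 0"
proof -
  have c: "((\<lambda>_. 1) has_real_derivative 0) (at x)" "((\<lambda>_. 0) has_real_derivative 0) (at x)" for x :: real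
    by (auto intro!: derivative_eq_intros)
  have 1: "nth_deriv 1 \<gamma>2 s = vector [1, g1 s]" if "\<bar>s\<bar> < e" for s
    using vector_derivative_\<gamma>2[OF that] by (simp add: nth_deriv_Suc)
  have 2: "nth_deriv 2 \<gamma>2 s = vector [0, g2 s]" if "\<bar>s\<bar> < e" for s
    unfolding numeral_2_eq_2 nth_deriv_Suc[of "Suc 0"]
    by (rule vector_derivative_transform_open[of "{-e<..<e}" _ _ "\<lambda>s. vector [1, g1 s]"])
       (use that 1 in \<open>auto intro!: has_vector_derivative_vector_2 g c\<close>)
  have 3: "nth_deriv 3 \<gamma>2 0 = vector [0, g3 0]"
    unfolding numeral_3_eq_3 nth_deriv_Suc[of "Suc (Suc 0)"]
    by (rule vector_derivative_transform_open[of "{-e<..<e}" _ _ "\<lambda>s. vector [0, g2 s]"])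
       (use e 2 in \<open>auto intro!: has_vector_derivative_vector_2 g c simp: numeral_2_eq_2\<close>)
  show ?thesis
    unfolding ordinary_inflection_at_def inflection_at_def 3 1[of 0, unfolded abs_zero, OF e]
      2[of 0, unfolded abs_zero, OF e] by (simp add: bracket_eq)
qed

lemma at_0:
  assumes "f 0 = 0" "f1 0 = 0"
  shows "W 0 0 = g1 0" "P 0 0 = g 0" "Q 0 0 = g 0"
    "\<Phi> 0 0 = (g 0)^3 * ((1 - \<alpha>) * f2 0 + \<alpha> * g2 0)"
    "\<Phi>_s 0 0 = \<alpha> * (3 * (g 0)\<^sup>2 * g1 0 * g2 0 + (g 0)^3 * g3 0)"
    "\<Phi>_t 0 0 = (1 - \<alpha>) * (3 * (g 0)\<^sup>2 * g1 0 * f2 0 + (g 0)^3 * f3 0)"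
    "S 0 0 = (1 - \<alpha>) * g 0 * (g1 0)\<^sup>2 + (g 0)\<^sup>2 * g2 0"
  by (simp_all add: W_def P_def Q_def \<Phi>_def \<Phi>_s_def \<Phi>_t_def S_def assms algebra_simps)

text \<open>The condition on \<open>b3\<close> is kept in the form \<open>D * b3 \<noteq> N\<close>,
  meaningful also for \<open>D = 0\<close>. The denominators are cleared by multiplication, which
  reduces the computation to polynomial identities.\<close>

lemma AEIL_regular_no_inflection:
  assumes f0: "f 0 = 0" "f1 0 = 0" "f2 0 = 1" "f3 0 = 6 * a3"
    and pos: "g 0 > 0" "g1 0 > 0" "a3 > 0"
    and \<Phi>0: "\<Phi> 0 0 = 0" and g3: "g3 0 = 6 * b3"
    and \<tau>: "contributing_curve \<alpha> \<gamma>1 \<gamma>2 \<tau>"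
  defines "N \<equiv> (\<alpha> - 1) * (- 6 * \<alpha> * a3 * g 0 * (g1 0)\<^sup>2 + 4 * \<alpha> * a3 * (g 0)\<^sup>2
      - 3 * \<alpha> * (g1 0)^3 - 2 * a3 * (g 0)\<^sup>2)"
    and "D \<equiv> 2 * \<alpha> * g 0 * (6 * \<alpha> * a3 * g 0 * g1 0 + 3 * \<alpha> * (g1 0)\<^sup>2 + 2 * \<alpha> * g 0 - g 0)"
  shows "AEIL_regular_at_0 \<alpha> \<gamma>1 \<gamma>2 \<tau> \<longleftrightarrow> \<alpha> \<noteq> g 0 / (g1 0)\<^sup>2 \<and> D * b3 \<noteq> N"
proof -
  define b0 b1 k p where "b0 = g 0" and "b1 = g1 0" and "k = g2 0" and "p = deriv \<tau> 0"
  have b: "b0 > 0" "b1 > 0" using pos by (auto simp: b0_def b1_def)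
  have k: "\<alpha> * k = \<alpha> - 1" using \<Phi>0 pos by (simp add: at_0 f0 k_def)
  \<comment> \<open>The factor of \<open>S 0 0\<close> that vanishes exactly at the excluded value
    of \<alpha>.\<close>
  define K where "K = \<alpha> * b1\<^sup>2 - b0"
  have S0: "\<alpha> * S 0 0 = (1 - \<alpha>) * b0 * K"
    unfolding at_0[OF f0(1,2)] b0_def[symmetric] b1_def[symmetric] k_def[symmetric] K_def using k by algebra
  have K0: "\<alpha> = g 0 / (g1 0)\<^sup>2 \<longleftrightarrow> K = 0"
    using b by (simp add: K_def b0_def[symmetric] b1_def[symmetric] eq_divide_eq)
  have W0: "W 0 0 \<noteq> 0" using pos by (simp add: at_0 f0)
  have fg: "f 0 \<noteq> g 0" using pos f0 by simp
  show ?thesis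
  proof (cases "K = 0")
    case True
    then have "S 0 0 = 0" using S0 \<alpha> by simp
    with not_AEIL_regular[OF \<tau> W0 fg] K0 True show ?thesis by simp
  next
    case False
    then have S: "S 0 0 \<noteq> 0" using S0 \<alpha> b by auto
    \<comment> \<open>The factor of \<open>\<Phi>_t 0 0\<close> on which the sign hypotheses bear:
      it is positive.\<close>
    define H where "H = b1 + 2 * a3 * b0"
    have H: "H > 0" using b pos by (simp add: H_def add_pos_pos)
    have \<Phi>t: "\<Phi>_t 0 0 = 3 * (1 - \<alpha>) * b0\<^sup>2 * H"
      unfolding at_0[OF f0(1,2)] f0 H_def b0_def b1_def by algebra
    then have \<Phi>t0: "\<Phi>_t 0 0 \<noteq> 0" using \<alpha> b H by simp
    have "p * \<Phi>_t 0 0 = - \<Phi>_s 0 0" using curve_deriv[OF \<tau> W0 \<Phi>t0] \<Phi>t0 by (simp add: p_def)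
    then have "3 * b0\<^sup>2 * ((1 - \<alpha>) * H * p) = 3 * b0\<^sup>2 * ((1 - \<alpha>) * b1 - 2 * \<alpha> * b0 * b3)"
      unfolding \<Phi>t at_0(5)[OF f0(1,2)] g3 b0_def[symmetric] b1_def[symmetric] k_def[symmetric]
      using k by algebra
    then have p: "(1 - \<alpha>) * H * p = (1 - \<alpha>) * b1 - 2 * \<alpha> * b0 * b3"
      using b by (metis mult_left_cancel less_irrefl mult_eq_0_iff power_not_zero zero_neq_numeral)
    \<comment> \<open>The numerator of the derivative of \<open>Q * W / S\<close> along the curve,
      by the quotient rule.\<close>
    define E where "E = (b1 * p * b1 + b0 * (k - p)) * S 0 0 - b0 * b1 *
      ((1 - \<alpha>) * (b1 * p * b1\<^sup>2 + 2 * b0 * b1 * (k - p)) + 2 * b0 * b1 * k + b0\<^sup>2 * (6 * b3))"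
    define l l' where "l = - (1 - \<alpha>) * b0 * b1 / S 0 0" and "l' = - (1 - \<alpha>) * E / (S 0 0)\<^sup>2"
    define x' where "x' = (1 - \<alpha>) * p + \<alpha> + l' * b0 + l * ((1 - \<alpha>) * b1 * p + \<alpha> * b1)"
    define y' where "y' = \<alpha> * b1 + l' * (\<alpha> * b0 * b1) + l * ((1 - \<alpha>) * b0 * p + \<alpha> * (b1\<^sup>2 + b0 * k))"
    have reg: "AEIL_regular_at_0 \<alpha> \<gamma>1 \<gamma>2 \<tau> \<longleftrightarrow> x' \<noteq> 0 \<or> y' \<noteq> 0"
      using AEIL_regular_iff[OF \<tau> W0 fg S curve_DERIV_intermediate[OF \<tau> W0 f0(1,2) S]]
      by (simp add: x'_def y'_def l_def l'_def E_def b0_def b1_def k_def p_def f0 g3)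
    have "l * S 0 0 = - (1 - \<alpha>) * b0 * b1" using S by (simp add: l_def)
    with S0 have "S 0 0 * (l * K) = S 0 0 * (- \<alpha> * b1)" by algebra
    then have lK: "l * K = - \<alpha> * b1" using S by (metis mult_left_cancel)
    have "(S 0 0)\<^sup>2 * (l' * ((1 - \<alpha>) * b0\<^sup>2 * K\<^sup>2)) = (S 0 0)\<^sup>2 * (- \<alpha>\<^sup>2 * E)"
    proof -
      have "(S 0 0)\<^sup>2 * l' = - (1 - \<alpha>) * E" using S by (simp add: l'_def)
      with S0 show ?thesis by algebra
    qed
    then have l'K: "l' * ((1 - \<alpha>) * b0\<^sup>2 * K\<^sup>2) = - \<alpha>\<^sup>2 * E"
      using S by (metis mult_left_cancel power_not_zero)
    \<comment> \<open>An envelope is tangent to its lines: \<open>N\<close> at the origin is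
      \<open>b0\<close> times \<open>(1, \<alpha> * b1)\<close>. Hence only \<open>x'\<close> has to
      be examined.\<close>
    have "K * y' = K * (\<alpha> * b1 * x')"
      using lK k unfolding x'_def y'_def K_def by algebra
    then have y: "y' = \<alpha> * b1 * x'" using False by (metis mult_left_cancel)
    \<comment> \<open>The factor \<open>K\<^sup>2 * (1 - \<alpha>)\<close> clears the denominators
      of \<open>l\<close> and \<open>l'\<close>, and \<open>H\<close> prepares the substitution for
      \<open>p\<close>.\<close>
    have "b0 * (x' * (K\<^sup>2 * (1 - \<alpha>) * H)) =
      H * (((1 - \<alpha>) * p + \<alpha>) * b0 * K\<^sup>2 * (1 - \<alpha>) - \<alpha>\<^sup>2 * E
        - \<alpha> * b1 * b0 * K * (1 - \<alpha>) * ((1 - \<alpha>) * b1 * p + \<alpha> * b1))"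
      using lK l'K unfolding x'_def by algebra
    \<comment> \<open>One factor \<alpha> turns \<open>k\<close> into \<open>\<alpha> - 1\<close>,
      the other clears \<open>S 0 0\<close> by
      \<open>\<alpha> * S 0 0 = (1 - \<alpha>) * b0 * K\<close>.\<close>
    also have "\<alpha>\<^sup>2 * E = (b1 * (\<alpha> * p) * b1 + b0 * (\<alpha> - 1 - \<alpha> * p)) * ((1 - \<alpha>) * b0 * K) - \<alpha> * b0 * b1 *
      ((1 - \<alpha>) * (b1 * (\<alpha> * p) * b1\<^sup>2 + 2 * b0 * b1 * (\<alpha> - 1 - \<alpha> * p)) + 2 * b0 * b1 * (\<alpha> - 1) + 6 * \<alpha> * b0\<^sup>2 * b3)"
      using S0 k unfolding E_def by algebra
    \<comment> \<open>Eliminating \<open>p\<close> by its linear relation with \<open>b3\<close>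
      produces the excluded value.\<close>
    also have "H * (((1 - \<alpha>) * p + \<alpha>) * b0 * K\<^sup>2 * (1 - \<alpha>) - \<dots>
        - \<alpha> * b1 * b0 * K * (1 - \<alpha>) * ((1 - \<alpha>) * b1 * p + \<alpha> * b1)) = b0 * (b0 * (D * b3 - N))"
      using p unfolding H_def K_def D_def N_def b0_def[symmetric] b1_def[symmetric] by algebra
    finally have x: "x' * (K\<^sup>2 * (1 - \<alpha>) * H) = b0 * (D * b3 - N)"
      using b by (metis mult_left_cancel less_irrefl)
    have "K\<^sup>2 * (1 - \<alpha>) * H \<noteq> 0" using False \<alpha> H by simp
    then have "x' = 0 \<longleftrightarrow> D * b3 = N" using x b
      by (metis eq_iff_diff_eq_0 less_irrefl mult_eq_0_iff)
    with reg y K0 False show ?thesis by auto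
  qed
qed

text \<open>At the origin the envelope point is the intersection of the two tangents, since
  \<open>l = - 1 / g1 0\<close>. In \<open>x'\<close> the motion of \<open>M\<close> cancels against
  that of \<open>N\<close>, leaving \<open>l' * g 0\<close>, and \<open>l'\<close> is a nonzero
  multiple of \<open>g3 0\<close>.\<close>

lemma AEIL_regular_inflection:
  assumes f0: "f 0 = 0" "f1 0 = 0" "f2 0 = 0" "f3 0 \<noteq> 0"
    and g0: "g 0 \<noteq> 0" "g1 0 \<noteq> 0" "g2 0 = 0" "g3 0 \<noteq> 0"
    and \<tau>: "contributing_curve \<alpha> \<gamma>1 \<gamma>2 \<tau>"
  shows "AEIL_regular_at_0 \<alpha> \<gamma>1 \<gamma>2 \<tau>"
proof -
  have W0: "W 0 0 \<noteq> 0" using g0 by (simp add: at_0 f0)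
  have fg: "f 0 \<noteq> g 0" using g0 f0 by simp
  have S: "S 0 0 \<noteq> 0" using g0 \<alpha> by (simp add: at_0 f0)
  have S_eq: "S 0 0 = (1 - \<alpha>) * g 0 * (g1 0)\<^sup>2" by (simp add: at_0 f0 g0)
  define l where "l = - (1 - \<alpha>) * g 0 * g1 0 / S 0 0"
  have l: "l * g1 0 = - 1" using g0 \<alpha> by (simp add: l_def S_eq power2_eq_square field_simps)
  define p where "p = deriv \<tau> 0"
  define E where "E = g1 0 * p * g1 0 * S 0 0 - g 0 * g1 0 * ((1 - \<alpha>) * (g1 0 * p * (g1 0)\<^sup>2) + (g 0)\<^sup>2 * g3 0)"
  have E: "E = - ((g 0)^3 * g1 0 * g3 0)"
    unfolding E_def S_eq by algebra
  define l' where "l' = - (1 - \<alpha>) * E / (S 0 0)\<^sup>2"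
  define x' where "x' = (1 - \<alpha>) * p + \<alpha> + l' * g 0 + l * ((1 - \<alpha>) * g1 0 * p + \<alpha> * g1 0)"
  define y' where "y' = \<alpha> * g1 0 + l' * (\<alpha> * g 0 * g1 0) + l * (\<alpha> * (g1 0)\<^sup>2)"
  have "AEIL_regular_at_0 \<alpha> \<gamma>1 \<gamma>2 \<tau> \<longleftrightarrow> x' \<noteq> 0 \<or> y' \<noteq> 0"
    using AEIL_regular_iff[OF \<tau> W0 fg S curve_DERIV_intermediate[OF \<tau> W0 f0(1,2) S]]
    by (simp add: x'_def y'_def l_def l'_def E_def p_def f0 g0)
  moreover have "x' = l' * g 0" using l unfolding x'_def by algebra
  moreover have "l' \<noteq> 0" using g0 S \<alpha> by (simp add: l'_def E)
  ultimately show ?thesis using g0 by simp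
qed

end

section \<open>The two cases, from the Taylor coefficients at the origin\<close>

theorem theorem4p2:
  fixes \<gamma> \<gamma>1 \<gamma>2 :: "real \<Rightarrow> real^2" and p1 p2 :: "real^2" and f g :: "real \<Rightarrow> real"
    and \<alpha> b0 b1 b2 b3 b4 b5 :: real
  assumes closed: "smooth_closed_curve \<gamma>"
    and alpha: "0 < \<alpha>" "\<alpha> < 1"
    and points: "p1 \<noteq> p2"
    and param1: "local_parametrization \<gamma> p1 \<gamma>1"
    and param2: "local_parametrization \<gamma> p2 \<gamma>2"
    and gamma1: "\<gamma>1 = (\<lambda>t. vector [t, f t])"
    and gamma2: "\<gamma>2 = (\<lambda>s. vector [s, g s])"
    and g_expansion:
      "(\<lambda>s. g s - (b0 + b1 * s + b2 * s^2 + b3 * s^3 + b4 * s^4 + b5 * s^5)) \<in> O[at 0](\<lambda>s. s^6)"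
    and nonparallel: "nonparallel_tangents \<gamma>1 \<gamma>2 0 0"
    and contributing: "contributes \<alpha> \<gamma>1 \<gamma>2 0 0"
  shows
    "(\<forall>a3 a4 a5 :: real.
        \<not> inflection_at \<gamma>1 0 \<and> \<not> inflection_at \<gamma>2 0 \<and>
        (\<lambda>t. f t - (1/2 * t^2 + a3 * t^3 + a4 * t^4 + a5 * t^5)) \<in> O[at 0](\<lambda>t. t^6) \<and>
        b0 > 0 \<and> b1 > 0 \<and> a3 > 0 \<and> b1^2 - b0 > 0 \<longrightarrow>
        b2 = (\<alpha> - 1) / (2 * \<alpha>) \<and>
        (\<exists>\<tau>. contributing_curve \<alpha> \<gamma>1 \<gamma>2 \<tau>) \<and>
        (\<forall>\<tau>. contributing_curve \<alpha> \<gamma>1 \<gamma>2 \<tau> \<longrightarrow>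
          (AEIL_regular_at_0 \<alpha> \<gamma>1 \<gamma>2 \<tau> \<longleftrightarrow>
            \<alpha> \<noteq> b0 / b1^2 \<and> \<alpha> \<noteq> 1 \<and>
            (let N = (\<alpha> - 1) * (- 6 * \<alpha> * a3 * b0 * b1^2 + 4 * \<alpha> * a3 * b0^2
                       - 3 * \<alpha> * b1^3 - 2 * a3 * b0^2);
                 D = 2 * \<alpha> * b0 * (6 * \<alpha> * a3 * b0 * b1 + 3 * \<alpha> * b1^2 + 2 * \<alpha> * b0 - b0)
             in D \<noteq> 0 \<longrightarrow> b3 \<noteq> N / D)))) \<and>
     (\<forall>a3 :: real.
        inflection_at \<gamma>1 0 \<and>
        (\<lambda>t. f t - a3 * t^3) \<in> O[at 0](\<lambda>t. t^4) \<and>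
        a3 \<noteq> 0 \<and> b0 * b1 \<noteq> 0 \<longrightarrow>
        b2 = 0 \<and>
        (\<exists>\<tau>. contributing_curve \<alpha> \<gamma>1 \<gamma>2 \<tau>) \<and>
        (\<forall>\<tau>. contributing_curve \<alpha> \<gamma>1 \<gamma>2 \<tau> \<longrightarrow>
          (b3 \<noteq> 0 \<longrightarrow> AEIL_regular_at_0 \<alpha> \<gamma>1 \<gamma>2 \<tau>)) \<and>
        (b3 \<noteq> 0 \<longleftrightarrow> ordinary_inflection_at \<gamma>2 0))"
proof -
  obtain e1 where e1: "e1 > 0" "\<forall>n. times_differentiable_on n {-e1<..<e1} f"
    using local_parametrization_graph[OF closed] param1 unfolding gamma1 by blast
  obtain e2 where e2: "e2 > 0" "\<forall>n. times_differentiable_on n {-e2<..<e2} g"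
    using local_parametrization_graph[OF closed] param2 unfolding gamma2 by blast
  define e where "e = min e1 e2"
  have e: "e > 0" using e1 e2 by (simp add: e_def)
  have tf: "times_differentiable_on n {-e<..<e} f" and tg: "times_differentiable_on n {-e<..<e} g" for n
    by (rule times_differentiable_on_subset[of n "{-e1<..<e1}"] times_differentiable_on_subset[of n "{-e2<..<e2}"];
        use e1(2) e2(2) in \<open>auto simp: e_def\<close>)+
  have D: "times_differentiable_on n {-e<..<e} (deriv h)"
    "\<And>x. \<bar>x\<bar> < e \<Longrightarrow> (h has_real_derivative deriv h x) (at x)"
    if "\<And>n. times_differentiable_on n {-e<..<e} h" for h n
    using times_differentiable_on_deriv[OF _ that, of n] times_differentiable_on_DERIV[OF that[of "Suc 0"]]
    by (auto simp: abs_less_iff)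
  define f1 f2 f3 g1 g2 g3 where "f1 = deriv f" and "f2 = deriv f1" and "f3 = deriv f2"
    and "g1 = deriv g" and "g2 = deriv g1" and "g3 = deriv g2"
  note defs = f1_def f2_def f3_def g1_def g2_def g3_def
  note Df = D(2)[OF tf] D(2)[OF D(1)[OF tf]] D(2)[OF D(1)[OF D(1)[OF tf]]] D(2)[OF D(1)[OF D(1)[OF D(1)[OF tf]]]]
  note Df = Df[folded defs]
  note Dg = D(2)[OF tg] D(2)[OF D(1)[OF tg]] D(2)[OF D(1)[OF D(1)[OF tg]]] D(2)[OF D(1)[OF D(1)[OF D(1)[OF tg]]]]
  note Dg = Dg[folded defs]
  interpret graph_pair \<alpha> e f f1 f2 f3 g g1 g2 g3
    using alpha e Df Dg D(1)[OF D(1)[OF D(1)[OF tf]]] D(1)[OF D(1)[OF D(1)[OF tg]]]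
    unfolding defs by unfold_locales
  \<comment> \<open>A remainder of order six is one of order four, as required for reading off the
    coefficients.\<close>
  have "(\<lambda>s :: real. s ^ 6) \<in> O[at 0](\<lambda>s. s ^ 4)"
  proof (rule bigoI[of _ 1])
    have "norm (s ^ 6) \<le> 1 * norm (s ^ 4)" if "\<bar>s\<bar> < 1" for s :: real
      using power_decreasing[of 4 6 "\<bar>s\<bar>"] that by simp
    then show "\<forall>\<^sub>F s :: real in at 0. norm (s ^ 6) \<le> 1 * norm (s ^ 4)"
      unfolding eventually_at by (intro exI[of _ 1]) simp
  qed
  note O = landau_o.big_trans[OF _ this]
  have g0: "g 0 = b0" "g1 0 = b1" "g2 0 = 2 * b2" "g3 0 = 6 * b3"
    using taylor_coefficients[OF e Dg O[OF g_expansion]] by simp_all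
  have W0: "W 0 0 \<noteq> 0"
    using nonparallel e unfolding gamma1 gamma2
    by (simp add: nonparallel_tangents_def vector_derivative_\<gamma>1 vector_derivative_\<gamma>2 bracket_eq W_def)
  \<comment> \<open>Non-parallel tangents rule out the factor \<open>W\<close> of the solvability
    determinant.\<close>
  have \<Phi>0: "\<Phi> 0 0 = 0"
    using contributing W0 e unfolding gamma1 gamma2 by (simp add: contributes_iff)
  have case_i: "b2 = (\<alpha> - 1) / (2 * \<alpha>) \<and> (\<exists>\<tau>. contributing_curve \<alpha> \<gamma>1 \<gamma>2 \<tau>) \<and>
      (\<forall>\<tau>. contributing_curve \<alpha> \<gamma>1 \<gamma>2 \<tau> \<longrightarrow>
        (AEIL_regular_at_0 \<alpha> \<gamma>1 \<gamma>2 \<tau> \<longleftrightarrow> \<alpha> \<noteq> b0 / b1^2 \<and> \<alpha> \<noteq> 1 \<and> (D \<noteq> 0 \<longrightarrow> b3 \<noteq> N / D)))"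
    if *: "(\<lambda>t. f t - (1/2 * t^2 + a3 * t^3 + a4 * t^4 + a5 * t^5)) \<in> O[at 0](\<lambda>t. t^6)"
      "b0 > 0" "b1 > 0" "a3 > 0"
      and N: "N = (\<alpha> - 1) * (- 6 * \<alpha> * a3 * b0 * b1^2 + 4 * \<alpha> * a3 * b0^2 - 3 * \<alpha> * b1^3 - 2 * a3 * b0^2)"
      and D: "D = 2 * \<alpha> * b0 * (6 * \<alpha> * a3 * b0 * b1 + 3 * \<alpha> * b1^2 + 2 * \<alpha> * b0 - b0)"
    for a3 a4 a5 N D
  proof -
    have "(\<lambda>t. f t - (0 + 0 * t + 1/2 * t^2 + a3 * t^3 + a4 * t^4 + a5 * t^5)) \<in> O[at 0](\<lambda>t. t^6)"
      using *(1) by simp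
    from taylor_coefficients[OF e Df O[OF this]]
    have f0: "f 0 = 0" "f1 0 = 0" "f2 0 = 1" "f3 0 = 6 * a3" by simp_all
    \<comment> \<open>This is \<open>\<Phi> 0 0 = 0\<close> divided by
      \<open>b0 ^ 3\<close>.\<close>
    have "(1 - \<alpha>) + \<alpha> * (2 * b2) = 0"
      using \<Phi>0 *(2) unfolding at_0(4)[OF f0(1,2)] f0 g0 by simp
    then have "b2 = (\<alpha> - 1) / (2 * \<alpha>)"
      using \<alpha> by (simp add: field_simps)
    moreover have "\<exists>\<tau>. contributing_curve \<alpha> \<gamma>1 \<gamma>2 \<tau>"
      unfolding gamma1 gamma2
    proof (rule exists_contributing_curve[OF \<Phi>0 _ W0])
      have "\<Phi>_t 0 0 > 0"
        using * \<alpha> by (simp add: at_0 f0 g0 add_pos_pos)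
      then show "\<Phi>_t 0 0 \<noteq> 0" by simp
    qed
    moreover have "AEIL_regular_at_0 \<alpha> \<gamma>1 \<gamma>2 \<tau> \<longleftrightarrow> \<alpha> \<noteq> b0 / b1^2 \<and> D * b3 \<noteq> N"
      if "contributing_curve \<alpha> \<gamma>1 \<gamma>2 \<tau>" for \<tau>
      using AEIL_regular_no_inflection[of a3 b3 \<tau>] f0 g0 * \<Phi>0 that unfolding gamma1 gamma2 N D by simp
    \<comment> \<open>For \<open>D = 0\<close> no value of \<open>b3\<close> is excluded, so
      \<open>D * b3 \<noteq> N\<close> has to hold automatically; the sign hypotheses ensure
      this.\<close>
    moreover have "N \<noteq> 0" if "D = 0"
    proof
      assume "N = 0"
      with \<alpha> have N0: "- 6 * \<alpha> * a3 * b0 * b1^2 + 4 * \<alpha> * a3 * b0^2 - 3 * \<alpha> * b1^3 - 2 * a3 * b0^2 = 0"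
        unfolding N by simp
      from that *(2) \<alpha> have D0: "6 * \<alpha> * a3 * b0 * b1 + 3 * \<alpha> * b1^2 + 2 * \<alpha> * b0 - b0 = 0"
        unfolding D by simp
      \<comment> \<open>The sum of \<open>N0\<close> and \<open>b1\<close> times \<open>D0\<close>,
        in which the terms cubic in \<open>b1\<close> and those with \<open>b0 * b1\<^sup>2\<close>
        cancel.\<close>
      from N0 D0 have "(2 * \<alpha> - 1) * (b0 * (b1 + 2 * a3 * b0)) = 0" by algebra
      moreover have "b0 * (b1 + 2 * a3 * b0) > 0" using * by (simp add: add_pos_pos)
      ultimately have "\<alpha> = 1 / 2" by auto
      with D0 have "3 * a3 * b0 * b1 + 3 / 2 * b1^2 = 0" by simp
      moreover have "3 * a3 * b0 * b1 + 3 / 2 * b1^2 > 0" using * by (simp add: add_pos_pos)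
      ultimately show False by simp
    qed
    then have "D * b3 \<noteq> N \<longleftrightarrow> (D \<noteq> 0 \<longrightarrow> b3 \<noteq> N / D)"
      by (cases "D = 0") (auto simp: eq_divide_eq mult.commute)
    ultimately show ?thesis using \<alpha> by simp
  qed
  have case_ii: "b2 = 0 \<and> (\<exists>\<tau>. contributing_curve \<alpha> \<gamma>1 \<gamma>2 \<tau>) \<and>
      (\<forall>\<tau>. contributing_curve \<alpha> \<gamma>1 \<gamma>2 \<tau> \<longrightarrow> (b3 \<noteq> 0 \<longrightarrow> AEIL_regular_at_0 \<alpha> \<gamma>1 \<gamma>2 \<tau>)) \<and>
      (b3 \<noteq> 0 \<longleftrightarrow> ordinary_inflection_at \<gamma>2 0)"
    if *: "(\<lambda>t. f t - a3 * t^3) \<in> O[at 0](\<lambda>t. t^4)" "a3 \<noteq> 0" "b0 * b1 \<noteq> 0" for a3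
  proof -
    have "(\<lambda>t. f t - (0 + 0 * t + 0 * t^2 + a3 * t^3 + 0 * t^4 + 0 * t^5)) \<in> O[at 0](\<lambda>t. t^4)"
      using *(1) by simp
    from taylor_coefficients[OF e Df this]
    have f0: "f 0 = 0" "f1 0 = 0" "f2 0 = 0" "f3 0 = 6 * a3" by simp_all
    \<comment> \<open>With \<open>f2 0 = 0\<close> the solvability condition reduces to
      \<open>b0 ^ 3 * \<alpha> * 2 * b2 = 0\<close>.\<close>
    have b2: "b2 = 0" using \<Phi>0 *(3) \<alpha> by (simp add: at_0 f0 g0)
    moreover have "\<exists>\<tau>. contributing_curve \<alpha> \<gamma>1 \<gamma>2 \<tau>"
      unfolding gamma1 gamma2
      by (rule exists_contributing_curve[OF \<Phi>0 _ W0]) (use * \<alpha> in \<open>simp add: at_0 f0 g0\<close>)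
    moreover have "AEIL_regular_at_0 \<alpha> \<gamma>1 \<gamma>2 \<tau>" if "contributing_curve \<alpha> \<gamma>1 \<gamma>2 \<tau>" "b3 \<noteq> 0" for \<tau>
      using AEIL_regular_inflection[of \<tau>] f0 g0 * b2 that unfolding gamma1 gamma2 by simp
    moreover have "b3 \<noteq> 0 \<longleftrightarrow> ordinary_inflection_at \<gamma>2 0"
      unfolding gamma2 ordinary_inflection_at_\<gamma>2 using g0 b2 by simp
    ultimately show ?thesis by blast
  qed
  show ?thesis
    unfolding Let_def using case_i[OF _ _ _ _ refl refl] case_ii by blast
qed

end
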